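(* Let $0\le\gamma<1$, $a\ne0$, $c$ and $b_j$ $(j\ge1)$ be real parameters and let $\{\zeta_t,t\in\mathbb{Z}\}$ be i.i.d. random variables with zero mean and unit variance. Let $\{r_t\}$ be a stationary $L^2$-solution of $$r_t=\zeta_t\sqrt{\sum_{\ell=0}^\infty\gamma^\ell\Big(c^2+\big(a+\sum_{s<t-\ell}b_{t-\ell-s}r_s\big)^2\Big)},\qquad t\in\mathbb{Z},\qquad( * )$$ with $\mathrm{E}|r_0|^3<\infty$ and $\mathrm{E}|\zeta_0|^3<\infty$. Assume in addition that $$B_{2,\gamma}:=\frac{1}{1-\gamma}\sum_{j=1}^\infty b_j^2<\frac15\qquad\text{and}\qquad\mu_3=\mathrm{E}\zeta_0^3=0.$$ Let $h_t:=\mathrm{E}[r_t^2r_0]$, $t\ge1$, be the leverage function. Then for any fixed $k$ with $1\le k\le\infty$: (i) if $ab_1<0$ and $ab_j\le0$ for $j=2,\dots,k$, then $\{r_t\}\in\ell(k)$, that is, $h_j<0$ for $1\le j\le k$; (ii) if $ab_1>0$ and $ab_j\ge0$ for $j=2,\dots,k$, then $h_j>0$ for $j=1,\dots,k$.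
   Context: Let $\mathcal{F}_t=\sigma(\zeta_s,s\le t)$. A process $\{u_t\}$ is adapted if $u_t$ is $\mathcal{F}_t$-measurable for each $t\in\mathbb{Z}$. An $L^2$-solution of $( * )$ is an adapted process $\{r_t,t\in\mathbb{Z}\}$ with $\mathrm{E}r_t^2<\infty$ such that for every $t\in\mathbb{Z}$ the series $X_t=\sum_{j=1}^\infty b_jr_{t-j}$ converges in $L^2$, the series $\sigma_t^2=\sum_{\ell=0}^\infty\gamma^\ell\big(c^2+(a+X_{t-\ell})^2\big)$ converges in $L^1$, and $( * )$ holds. Stationary means strictly stationary. The leverage function is $h_t=\mathrm{cov}(\sigma_t^2,r_0)=\mathrm{E}[r_t^2r_0]$, $t\ge1$, and $\{r_t\}$ is said to have leverage of order $k$, written $\{r_t\}\in\ell(k)$, if $h_j<0$ for all $1\le j\le k$ (for $k=\infty$: for all integers $j\ge1$). *)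

theory Defs
  imports "HOL-Probability.Probability"
begin

definition generated_by_past :: "'a measure \<Rightarrow> (int \<Rightarrow> 'a \<Rightarrow> real) \<Rightarrow> int \<Rightarrow> 'a measure" where
  "generated_by_past M \<zeta> t =
     sigma (space M) {\<zeta> s -` A \<inter> space M | s A. s \<le> t \<and> A \<in> sets borel}"

definition adapted_to :: "(int \<Rightarrow> 'a measure) \<Rightarrow> (int \<Rightarrow> 'a \<Rightarrow> real) \<Rightarrow> bool" where
  "adapted_to F u \<longleftrightarrow> (\<forall>t. u t \<in> borel_measurable (F t))"

definition strictly_stationary :: "'a measure \<Rightarrow> (int \<Rightarrow> 'a \<Rightarrow> real) \<Rightarrow> bool" where
  "strictly_stationary M u \<longleftrightarrow>
     (\<forall>t. u t \<in> borel_measurable M) \<and>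
     (\<forall>J h. finite J \<longrightarrow>
        distr M (Pi\<^sub>M J (\<lambda>_. borel)) (\<lambda>\<omega>. \<lambda>t\<in>J. u (t + h) \<omega>) =
        distr M (Pi\<^sub>M J (\<lambda>_. borel)) (\<lambda>\<omega>. \<lambda>t\<in>J. u t \<omega>))"

definition in_Lp :: "nat \<Rightarrow> 'a measure \<Rightarrow> ('a \<Rightarrow> real) \<Rightarrow> bool" where
  "in_Lp p M f \<longleftrightarrow> f \<in> borel_measurable M \<and> integrable M (\<lambda>\<omega>. \<bar>f \<omega>\<bar> ^ p)"

text \<open>Membership in \<open>L\<^sup>p\<close> of the terms and of the sum is required explicitly, because the Bochner
  integral of a non-integrable function is \<open>0\<close>. The sum \<open>S\<close> is determined only almost everywhere.\<close>

definition sums_in_Lp :: "nat \<Rightarrow> 'a measure \<Rightarrow> (nat \<Rightarrow> 'a \<Rightarrow> real) \<Rightarrow> ('a \<Rightarrow> real) \<Rightarrow> bool" where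
  "sums_in_Lp p M f S \<longleftrightarrow>
     (\<forall>n. in_Lp p M (f n)) \<and> in_Lp p M S \<and>
     (\<lambda>N. \<integral>\<omega>. \<bar>(\<Sum>n<N. f n \<omega>) - S \<omega>\<bar> ^ p \<partial>M) \<longlonglongrightarrow> 0"

text \<open>The coefficients \<open>b\<^sub>j\<close> are indexed by \<open>j \<ge> 1\<close>; the value \<open>b 0\<close> is never used. The processes
  \<open>X\<close> and \<open>\<sigma>2\<close> are (versions of) the \<open>L\<^sup>2\<close>-sum \<open>X\<^sub>t\<close> and the \<open>L\<^sup>1\<close>-sum \<open>\<sigma>\<^sub>t\<^sup>2\<close>.\<close>

definition L2_solution ::
    "'a measure \<Rightarrow> (int \<Rightarrow> 'a \<Rightarrow> real) \<Rightarrow> real \<Rightarrow> real \<Rightarrow> real \<Rightarrow> (nat \<Rightarrow> real) \<Rightarrow>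
     (int \<Rightarrow> 'a \<Rightarrow> real) \<Rightarrow> bool" where
  "L2_solution M \<zeta> \<gamma> a c b r \<longleftrightarrow>
     adapted_to (generated_by_past M \<zeta>) r \<and>
     (\<forall>t. integrable M (\<lambda>\<omega>. (r t \<omega>)\<^sup>2)) \<and>
     (\<exists>X \<sigma>2.
        (\<forall>t. sums_in_Lp 2 M (\<lambda>j \<omega>. b (Suc j) * r (t - int (Suc j)) \<omega>) (X t)) \<and>
        (\<forall>t. sums_in_Lp 1 M (\<lambda>l \<omega>. \<gamma> ^ l * (c\<^sup>2 + (a + X (t - int l) \<omega>)\<^sup>2)) (\<sigma>2 t)) \<and>
        (\<forall>t. AE \<omega> in M. r t \<omega> = \<zeta> t \<omega> * sqrt (\<sigma>2 t \<omega>)))"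

definition leverage :: "'a measure \<Rightarrow> (int \<Rightarrow> 'a \<Rightarrow> real) \<Rightarrow> nat \<Rightarrow> real" where
  "leverage M r t = (\<integral>\<omega>. (r (int t) \<omega>)\<^sup>2 * r 0 \<omega> \<partial>M)"

definition has_leverage_of_order :: "'a measure \<Rightarrow> (int \<Rightarrow> 'a \<Rightarrow> real) \<Rightarrow> enat \<Rightarrow> bool" where
  "has_leverage_of_order M r k \<longleftrightarrow> (\<forall>j\<ge>1. enat j \<le> k \<longrightarrow> leverage M r j < 0)"

end

theory Submission
  imports Defs
begin

text \<open>Write \<open>m = E r\<^sub>0\<^sup>2\<close> and \<open>h\<^sub>0 = E r\<^sub>0\<^sup>3 = 0\<close>. Taking expectations in
  \<open>\<sigma>\<^sub>t\<^sup>2 r\<^sub>0 = \<gamma> \<sigma>\<^sub>t\<^sub>-\<^sub>1\<^sup>2 r\<^sub>0 + (c\<^sup>2 + (a + X\<^sub>t)\<^sup>2) r\<^sub>0\<close> and using that \<open>r\<close> is a martingale difference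
  gives, for \<open>t \<ge> 1\<close>, the linear recursion
  \<open>h\<^sub>t = \<gamma> h\<^sub>t\<^sub>-\<^sub>1 + \<Sum>\<^sub>0\<^sub><\<^sub>u\<^sub><\<^sub>t b\<^sub>t\<^sub>-\<^sub>u\<^sup>2 h\<^sub>u + 2 b\<^sub>t (a m + w\<^sub>t)\<close> with \<open>w\<^sub>t = \<Sum>\<^sub>i\<^sub>\<ge>\<^sub>1 b\<^sub>t\<^sub>+\<^sub>i h\<^sub>i\<close>.
  A third-moment inequality for linear combinations of the \<open>r\<^sub>s\<close> shows by duality that \<open>h\<close> is square
  summable. Taking \<open>\<ell>\<^sup>2\<close> norms in the recursion, with \<open>B\<^sup>2 = \<Sum> b\<^sub>j\<^sup>2\<close>, gives
  \<open>(1 - \<gamma> - 3 B\<^sup>2) \<parallel>h\<parallel> \<le> 2 B \<bar>a\<bar> m\<close>, so \<open>\<bar>w\<^sub>t\<bar> \<le> B \<parallel>h\<parallel> < \<bar>a\<bar> m\<close> as soon as \<open>5 B\<^sup>2 < 1 - \<gamma>\<close>.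
  Hence \<open>a m + w\<^sub>t\<close> has the sign of \<open>a\<close>, and the sign of \<open>h\<^sub>t\<close> follows by induction.\<close>

section \<open>The recursion for square summable sequences\<close>

text \<open>Young's convolution inequality for l^1 * l^2 into l^2, on truncated sequences. It is
  applied with \<open>k\<close> the squares of the coefficients, so the factor
  \<open>suminf k\<close> becomes \<open>B\<^sup>2\<close>.\<close>

lemma L2_set_convolution_le:
  fixes k h :: "nat \<Rightarrow> real"
  assumes "summable k" "\<And>j. 0 \<le> k j"
  shows "L2_set (\<lambda>n. \<Sum>u\<le>n. k (n - u) * h u) {..<N} \<le> suminf k * L2_set h {..<N}"
proof -
  let ?K = "suminf k"
  have K: "(\<Sum>j\<in>A. k j) \<le> ?K" if "finite A" for A
    using sum_le_suminf[OF assms(1) that] assms(2) by auto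
  have K0: "0 \<le> ?K" using K[of "{}"] by simp
  have pt: "(\<Sum>u\<le>n. k (n - u) * h u)\<^sup>2 \<le> ?K * (\<Sum>u\<le>n. k (n - u) * (h u)\<^sup>2)" for n
  proof -
    \<comment> \<open>Half of the weight goes to each factor of Cauchy-Schwarz: one factor is then
      at most \<open>?K\<close>, the other stays linear in the kernel and can be summed over
      \<open>n\<close>.\<close>
    have "(\<Sum>u\<le>n. k (n - u) * h u)\<^sup>2 = (\<Sum>u\<le>n. sqrt (k (n - u)) * (sqrt (k (n - u)) * h u))\<^sup>2"
      using assms(2) by (simp flip: mult.assoc)
    also have "\<dots> \<le> (\<Sum>u\<le>n. (sqrt (k (n - u)))\<^sup>2) * (\<Sum>u\<le>n. (sqrt (k (n - u)) * h u)\<^sup>2)"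
      by (rule Cauchy_Schwarz_ineq_sum)
    also have "\<dots> = (\<Sum>u\<le>n. k (n - u)) * (\<Sum>u\<le>n. k (n - u) * (h u)\<^sup>2)"
      using assms(2) by (simp add: power_mult_distrib)
    also have "(\<Sum>u\<le>n. k (n - u)) = (\<Sum>u\<le>n. k u)"
      by (rule sum.reindex_bij_witness[of _ "\<lambda>u. n - u" "\<lambda>u. n - u"]) auto
    also have "(\<Sum>u\<le>n. k u) * (\<Sum>u\<le>n. k (n - u) * (h u)\<^sup>2) \<le> ?K * (\<Sum>u\<le>n. k (n - u) * (h u)\<^sup>2)"
      by (intro mult_right_mono K sum_nonneg) (auto simp: assms)
    finally show ?thesis .
  qed
  have "(\<Sum>n<N. (\<Sum>u\<le>n. k (n - u) * h u)\<^sup>2) \<le> (\<Sum>n<N. ?K * (\<Sum>u\<le>n. k (n - u) * (h u)\<^sup>2))"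
    by (intro sum_mono pt)
  \<comment> \<open>Writing the triangle u \<le> n < N with both indices below \<open>N\<close>
    makes it possible to exchange the sums.\<close>
  also have "\<dots> = ?K * (\<Sum>n<N. \<Sum>u\<in>{u\<in>{..<N}. u \<le> n}. k (n - u) * (h u)\<^sup>2)"
    unfolding sum_distrib_left[symmetric] by (intro arg_cong2[where f="(*)"] refl sum.cong) auto
  also have "(\<Sum>n<N. \<Sum>u\<in>{u\<in>{..<N}. u \<le> n}. k (n - u) * (h u)\<^sup>2)
      = (\<Sum>u<N. \<Sum>n\<in>{n\<in>{..<N}. u \<le> n}. k (n - u) * (h u)\<^sup>2)"
    by (rule sum.swap_restrict) auto
  also have "\<dots> \<le> (\<Sum>u<N. ?K * (h u)\<^sup>2)"
  proof (rule sum_mono)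
    fix u
    have "(\<Sum>n\<in>{n\<in>{..<N}. u \<le> n}. k (n - u)) = sum k ((\<lambda>n. n - u) ` {n\<in>{..<N}. u \<le> n})"
      by (subst sum.reindex) (auto simp: inj_on_def)
    also have "\<dots> \<le> ?K" by (rule K) auto
    finally show "(\<Sum>n\<in>{n\<in>{..<N}. u \<le> n}. k (n - u) * (h u)\<^sup>2) \<le> ?K * (h u)\<^sup>2"
      unfolding sum_distrib_right[symmetric] by (intro mult_right_mono) auto
  qed
  finally have "(\<Sum>n<N. (\<Sum>u\<le>n. k (n - u) * h u)\<^sup>2) \<le> ?K\<^sup>2 * (\<Sum>u<N. (h u)\<^sup>2)"
    using K0 by (simp add: mult_left_mono power2_eq_square sum_distrib_left mult.assoc)
  then have "sqrt (\<Sum>n<N. (\<Sum>u\<le>n. k (n - u) * h u)\<^sup>2) \<le> sqrt (?K\<^sup>2 * (\<Sum>u<N. (h u)\<^sup>2))"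
    by (rule real_sqrt_le_mono)
  then show ?thesis using K0 by (simp add: L2_set_def real_sqrt_mult)
qed

lemma L2_set_le_sqrt_suminf:
  fixes f :: "nat \<Rightarrow> real"
  assumes "summable (\<lambda>n. (f n)\<^sup>2)"
  shows "L2_set f {..<N} \<le> sqrt (\<Sum>n. (f n)\<^sup>2)"
  unfolding L2_set_def by (intro real_sqrt_le_mono sum_le_suminf assms) auto

lemma Cauchy_Schwarz_suminf:
  fixes f g :: "nat \<Rightarrow> real"
  assumes f: "summable (\<lambda>n. (f n)\<^sup>2)" and g: "summable (\<lambda>n. (g n)\<^sup>2)"
  shows "summable (\<lambda>n. f n * g n)"
    and "\<bar>\<Sum>n. f n * g n\<bar> \<le> sqrt (\<Sum>n. (f n)\<^sup>2) * sqrt (\<Sum>n. (g n)\<^sup>2)"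
proof -
  have bd: "(\<Sum>n<N. \<bar>f n * g n\<bar>) \<le> sqrt (\<Sum>n. (f n)\<^sup>2) * sqrt (\<Sum>n. (g n)\<^sup>2)" for N
  proof -
    have "(\<Sum>n<N. \<bar>f n * g n\<bar>) \<le> L2_set f {..<N} * L2_set g {..<N}"
      unfolding abs_mult by (rule L2_set_mult_ineq)
    also have "\<dots> \<le> sqrt (\<Sum>n. (f n)\<^sup>2) * sqrt (\<Sum>n. (g n)\<^sup>2)"
      by (intro mult_mono L2_set_le_sqrt_suminf f g L2_set_nonneg real_sqrt_ge_zero suminf_nonneg) auto
    finally show ?thesis .
  qed
  have sa: "summable (\<lambda>n. \<bar>f n * g n\<bar>)"
    by (rule bounded_imp_summable[of _ "sqrt (\<Sum>n. (f n)\<^sup>2) * sqrt (\<Sum>n. (g n)\<^sup>2)"])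
       (use bd[of "Suc _"] in \<open>auto simp: lessThan_Suc_atMost\<close>)
  then show "summable (\<lambda>n. f n * g n)" by (rule summable_rabs_cancel)
  have "\<bar>\<Sum>n. f n * g n\<bar> \<le> (\<Sum>n. \<bar>f n * g n\<bar>)" by (rule summable_rabs[OF sa])
  also have "\<dots> \<le> sqrt (\<Sum>n. (f n)\<^sup>2) * sqrt (\<Sum>n. (g n)\<^sup>2)" by (rule suminf_le_const[OF sa bd])
  finally show "\<bar>\<Sum>n. f n * g n\<bar> \<le> sqrt (\<Sum>n. (f n)\<^sup>2) * sqrt (\<Sum>n. (g n)\<^sup>2)" .
qed

text \<open>As \<open>h\<close> is already known to have finite norm \<open>H\<close>, its own
  contributions to the right-hand side can be absorbed: the factor \<open>\<gamma>\<close>, the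
  convolution with total mass \<open>B\<^sup>2\<close>, and the feedback through \<open>w\<close> of
  size \<open>2 * B\<^sup>2\<close>. What remains is H (1 - \<gamma> - 3 B^2) \<le> 2 B |d|. The
  bound 1/5 is exactly what makes 2 B^2 < 1 - \<gamma> - 3 B^2, hence B H < |d|.\<close>

lemma leverage_recursion_perturbation_small:
  fixes h \<beta> w :: "nat \<Rightarrow> real"
  assumes \<gamma>: "0 \<le> \<gamma>" "\<gamma> < 1"
    and \<beta>: "summable (\<lambda>j. (\<beta> j)\<^sup>2)" "1 / (1 - \<gamma>) * (\<Sum>j. (\<beta> j)\<^sup>2) < 1 / 5"
    and h: "summable (\<lambda>n. (h n)\<^sup>2)" "h 0 = 0"
    and rec: "\<And>n. h (Suc n) = \<gamma> * h n + (\<Sum>u\<le>n. (\<beta> (n - u))\<^sup>2 * h u) + 2 * \<beta> n * (d + w n)"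
    and w: "\<And>n. w n = (\<Sum>i. \<beta> (Suc n + i) * h (Suc i))"
    and d: "d \<noteq> 0"
  shows "\<bar>w n\<bar> < \<bar>d\<bar>"
proof -
  define H where "H = sqrt (\<Sum>n. (h n)\<^sup>2)"
  define B where "B = sqrt (\<Sum>j. (\<beta> j)\<^sup>2)"
  have [simp]: "0 \<le> H" "0 \<le> B" unfolding H_def B_def by (auto intro!: real_sqrt_ge_zero suminf_nonneg h \<beta>)
  have B2: "(\<Sum>j. (\<beta> j)\<^sup>2) = B\<^sup>2" unfolding B_def using suminf_nonneg[OF \<beta>(1)] by simp
  have H2: "(\<Sum>j. (h j)\<^sup>2) = H\<^sup>2" unfolding H_def using suminf_nonneg[OF h(1)] by simp
  have wle: "\<bar>w n\<bar> \<le> B * H" for n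
  proof -
    have s: "summable (\<lambda>i. (\<beta> (Suc n + i))\<^sup>2)" "summable (\<lambda>i. (h (Suc i))\<^sup>2)"
      using summable_ignore_initial_segment[OF \<beta>(1), of "Suc n"] h(1)
      by (simp_all add: add.commute summable_Suc_iff[of "\<lambda>i. (h i)\<^sup>2"])
    have "\<bar>w n\<bar> \<le> sqrt (\<Sum>i. (\<beta> (Suc n + i))\<^sup>2) * sqrt (\<Sum>i. (h (Suc i))\<^sup>2)"
      unfolding w by (rule Cauchy_Schwarz_suminf(2)[OF s])
    also have "(\<Sum>i. (h (Suc i))\<^sup>2) = H\<^sup>2"
      using suminf_split_head[OF h(1)] h(2) H2 by simp
    also have "(\<Sum>i. (\<beta> (Suc n + i))\<^sup>2) \<le> B\<^sup>2"
      using suminf_split_initial_segment[OF \<beta>(1), of "Suc n"] sum_nonneg[of "{..<Suc n}" "\<lambda>i. (\<beta> i)\<^sup>2"]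
      unfolding B2 by (simp add: add.commute)
    finally show ?thesis by (simp add: mult_right_mono)
  qed
  have Hle: "H \<le> \<gamma> * H + B\<^sup>2 * H + 2 * B * (\<bar>d\<bar> + B * H)" (is "_ \<le> ?R")
  proof -
    have "L2_set h {..<Suc N} \<le> ?R" for N
    proof -
      have hN: "L2_set h {..<N} \<le> H" unfolding H_def by (rule L2_set_le_sqrt_suminf[OF h(1)])
      \<comment> \<open>Since \<open>h 0 = 0\<close>, shifting the index by one does not change the
        norm.\<close>
      have "L2_set h {..<Suc N} = L2_set (\<lambda>n. h (Suc n)) {..<N}"
        unfolding L2_set_def by (subst sum.lessThan_Suc_shift) (simp add: h(2))
      also have "\<dots> = L2_set (\<lambda>n. (\<gamma> * h n + (\<Sum>u\<le>n. (\<beta> (n - u))\<^sup>2 * h u)) + 2 * \<beta> n * (d + w n)) {..<N}"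
        by (simp add: rec)
      also have "\<dots> \<le> L2_set (\<lambda>n. \<gamma> * h n) {..<N} + L2_set (\<lambda>n. \<Sum>u\<le>n. (\<beta> (n - u))\<^sup>2 * h u) {..<N}
          + L2_set (\<lambda>n. 2 * \<beta> n * (d + w n)) {..<N}"
        by (rule order_trans[OF L2_set_triangle_ineq]) (intro add_right_mono L2_set_triangle_ineq)
      also have "L2_set (\<lambda>n. \<gamma> * h n) {..<N} \<le> \<gamma> * H"
        using hN \<gamma> by (simp add: L2_set_right_distrib[symmetric] mult_left_mono)
      also have "L2_set (\<lambda>n. \<Sum>u\<le>n. (\<beta> (n - u))\<^sup>2 * h u) {..<N} \<le> B\<^sup>2 * H"
        using L2_set_convolution_le[OF \<beta>(1), of h N] hN unfolding B2
        by (meson mult_left_mono order_trans zero_le_power2)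
      also have "L2_set (\<lambda>n. 2 * \<beta> n * (d + w n)) {..<N} \<le> 2 * B * (\<bar>d\<bar> + B * H)"
      proof -
        have "L2_set (\<lambda>n. 2 * \<beta> n * (d + w n)) {..<N} = L2_set (\<lambda>n. \<bar>2 * \<beta> n * (d + w n)\<bar>) {..<N}"
          by (simp add: L2_set_def)
        also have "\<dots> \<le> L2_set (\<lambda>n. (2 * (\<bar>d\<bar> + B * H)) * \<bar>\<beta> n\<bar>) {..<N}"
        proof (intro L2_set_mono)
          fix n
          have "\<bar>d + w n\<bar> \<le> \<bar>d\<bar> + B * H" using wle[of n] by linarith
          then have "\<bar>d + w n\<bar> * \<bar>\<beta> n\<bar> \<le> (\<bar>d\<bar> + B * H) * \<bar>\<beta> n\<bar>" by (rule mult_right_mono) simp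
          then show "\<bar>2 * \<beta> n * (d + w n)\<bar> \<le> 2 * (\<bar>d\<bar> + B * H) * \<bar>\<beta> n\<bar>"
            unfolding abs_mult by (simp add: mult.assoc del: distrib_left_numeral) (simp add: algebra_simps)
        qed simp
        also have "\<dots> = 2 * (\<bar>d\<bar> + B * H) * L2_set \<beta> {..<N}"
          by (subst L2_set_right_distrib[symmetric]) (simp_all add: L2_set_def)
        also have "\<dots> \<le> 2 * (\<bar>d\<bar> + B * H) * B"
          unfolding B_def[symmetric]
          by (intro mult_left_mono L2_set_le_sqrt_suminf[OF \<beta>(1), folded B_def]) simp
        finally show ?thesis by (simp add: algebra_simps)
      qed
      finally show ?thesis by simp
    qed
    then have "(\<Sum>n<N. (h n)\<^sup>2) \<le> ?R\<^sup>2" for N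
    proof -
      have "(\<Sum>n<N. (h n)\<^sup>2) \<le> (\<Sum>n<Suc N. (h n)\<^sup>2)" by simp
      also have "\<dots> = (L2_set h {..<Suc N})\<^sup>2" by (simp add: L2_set_def sum_nonneg)
      also have "\<dots> \<le> ?R\<^sup>2"
        using \<open>\<And>N. L2_set h {..<Suc N} \<le> ?R\<close> by (intro power_mono L2_set_nonneg)
      finally show ?thesis .
    qed
    then have "H\<^sup>2 \<le> ?R\<^sup>2" unfolding H2[symmetric] by (intro suminf_le_const h)
    moreover have "0 \<le> ?R" using \<gamma> by simp
    ultimately show ?thesis by (rule power2_le_imp_le)
  qed
  have q: "5 * B\<^sup>2 < 1 - \<gamma>" using \<beta>(2) \<gamma> unfolding B2 by (simp add: field_simps)
  then have p: "0 < 1 - \<gamma> - 3 * B\<^sup>2" using zero_le_power2[of B] by linarith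
  have "H * (1 - \<gamma> - 3 * B\<^sup>2) \<le> 2 * B * \<bar>d\<bar>"
    using Hle by (simp add: algebra_simps power2_eq_square)
  then have "B * (H * (1 - \<gamma> - 3 * B\<^sup>2)) \<le> B * (2 * B * \<bar>d\<bar>)" by (rule mult_left_mono) simp
  then have "B * H * (1 - \<gamma> - 3 * B\<^sup>2) \<le> 2 * B\<^sup>2 * \<bar>d\<bar>" by (simp add: algebra_simps power2_eq_square)
  \<comment> \<open>Here 5 B^2 < 1 - \<gamma> enters. Strictness has to come from this step and
    \<open>d \<noteq> 0\<close>, because \<open>B\<close> itself may be zero.\<close>
  also have "\<dots> < (1 - \<gamma> - 3 * B\<^sup>2) * \<bar>d\<bar>" using d q by (intro mult_strict_right_mono) auto
  finally have "B * H < \<bar>d\<bar>" using p by (simp add: mult.commute)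
  then show ?thesis using wle[of n] by linarith
qed

text \<open>The factor \<open>e\<close> treats both signs at once; it will be 1 or -1. A
  perturbation smaller than |d| leaves (d + w n) / d positive, so the inhomogeneous term inherits
  the sign of e d \<beta>_n and all other terms of the recursion preserve the sign by strong
  induction.\<close>

lemma leverage_recursion_sign:
  fixes h \<beta> w :: "nat \<Rightarrow> real"
  assumes \<gamma>: "0 \<le> \<gamma>"
    and h0: "h 0 = 0"
    and rec: "\<And>n. h (Suc n) = \<gamma> * h n + (\<Sum>u\<le>n. (\<beta> (n - u))\<^sup>2 * h u) + 2 * \<beta> n * (d + w n)"
    and w: "\<And>n. \<bar>w n\<bar> < \<bar>d\<bar>"
    and first: "0 < e * (d * \<beta> 0)" and rest: "\<And>j. j \<le> n \<Longrightarrow> 0 \<le> e * (d * \<beta> j)"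
  shows "0 < e * h (Suc n)"
proof -
  have drv: "e * (2 * \<beta> n * (d + w n)) = 2 * (e * (d * \<beta> n)) * ((d + w n) / d)" and
    pos: "0 < (d + w n) / d" for n
  proof -
    have d: "d \<noteq> 0" using w[of 0] by auto
    then show "e * (2 * \<beta> n * (d + w n)) = 2 * (e * (d * \<beta> n)) * ((d + w n) / d)" by simp
    show "0 < (d + w n) / d" using w[of n] d by (cases "0 < d") (auto simp: zero_less_divide_iff)
  qed
  show ?thesis using rest
  proof (induction n rule: less_induct)
    case (less n)
    have IH: "0 < e * h u" if "0 < u" "u \<le> n" for u
      using less.IH[of "u - 1"] less.prems that by auto
    then have IH0: "0 \<le> e * h u" if "u \<le> n" for u
      using that h0 by (cases "u = 0") (auto intro: less_imp_le)
    have eq: "e * h (Suc n) = \<gamma> * (e * h n) + (\<Sum>u\<le>n. (\<beta> (n - u))\<^sup>2 * (e * h u)) + e * (2 * \<beta> n * (d + w n))"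
      by (simp add: rec distrib_left sum_distrib_left mult.left_commute)
    have 1: "0 \<le> \<gamma> * (e * h n)" using \<gamma> IH0[of n] by simp
    have 2: "0 \<le> (\<Sum>u\<le>n. (\<beta> (n - u))\<^sup>2 * (e * h u))" by (intro sum_nonneg mult_nonneg_nonneg IH0) auto
    have 3: "0 \<le> e * (2 * \<beta> n * (d + w n))" unfolding drv
      using mult_nonneg_nonneg[OF less.prems[OF order_refl] less_imp_le[OF pos[of n]]] by linarith
    show ?case
    proof (cases n)
      case 0
      then have "0 < e * (2 * \<beta> n * (d + w n))" unfolding drv using mult_pos_pos[OF first pos[of n]] by (simp only: mult.assoc)
      then show ?thesis using eq 1 2 by linarith
    next
      case (Suc m)
      \<comment> \<open>For n > 0 the inhomogeneous term may vanish. Strict positivity then comes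
        from the summand u = n, whose weight is the square of \<open>\<beta> 0\<close>, nonzero by
        \<open>first\<close>.\<close>
      have "0 < (\<beta> (n - n))\<^sup>2 * (e * h n)" 
        using IH[of n] Suc by (intro mult_pos_pos[of "_\<^sup>2"]) (use first in auto)
      also have "\<dots> \<le> (\<Sum>u\<le>n. (\<beta> (n - u))\<^sup>2 * (e * h u))"
        by (rule member_le_sum) (auto intro!: mult_nonneg_nonneg IH0)
      finally show ?thesis using eq 1 3 by linarith
    qed
  qed
qed

section \<open>Convergence in \<open>L\<^sup>p\<close> and measurability up to null sets\<close>

lemma in_Lp_add:
  assumes "in_Lp p M f" "in_Lp p M g"
  shows "in_Lp p M (\<lambda>\<omega>. f \<omega> + g \<omega>)"
proof -
  note [measurable] = assms[unfolded in_Lp_def, THEN conjunct1]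
  have "\<bar>x + y\<bar> ^ p \<le> 2 ^ p * (\<bar>x\<bar> ^ p + \<bar>y\<bar> ^ p)" for x y :: real
  proof -
    have "\<bar>x + y\<bar> ^ p \<le> (2 * max \<bar>x\<bar> \<bar>y\<bar>) ^ p" by (intro power_mono) auto
    also have "\<dots> = 2 ^ p * (max \<bar>x\<bar> \<bar>y\<bar>) ^ p" by (rule power_mult_distrib)
    also have "(max \<bar>x\<bar> \<bar>y\<bar>) ^ p \<le> \<bar>x\<bar> ^ p + \<bar>y\<bar> ^ p" by (auto simp: max_def)
    finally show ?thesis by simp
  qed
  then have ae: "AE \<omega> in M. norm (\<bar>f \<omega> + g \<omega>\<bar> ^ p) \<le> norm (2 ^ p * (\<bar>f \<omega>\<bar> ^ p + \<bar>g \<omega>\<bar> ^ p))"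
    by (intro AE_I2) (simp add: abs_mult)
  have i: "integrable M (\<lambda>\<omega>. 2 ^ p * (\<bar>f \<omega>\<bar> ^ p + \<bar>g \<omega>\<bar> ^ p))"
    using assms by (simp add: in_Lp_def)
  have "integrable M (\<lambda>\<omega>. \<bar>f \<omega> + g \<omega>\<bar> ^ p)"
    by (rule Bochner_Integration.integrable_bound[OF i _ ae]) measurable
  then show ?thesis by (simp add: in_Lp_def)
qed

lemma in_Lp_cmult: "in_Lp p M f \<Longrightarrow> in_Lp p M (\<lambda>\<omega>. k * f \<omega>)"
  by (auto simp: in_Lp_def abs_mult power_mult_distrib)

lemma in_Lp_diff: "in_Lp p M f \<Longrightarrow> in_Lp p M g \<Longrightarrow> in_Lp p M (\<lambda>\<omega>. f \<omega> - g \<omega>)"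
  using in_Lp_add[of p M f "\<lambda>\<omega>. -1 * g \<omega>"] in_Lp_cmult[of p M g "-1"] by simp

lemma in_Lp_0: "0 < p \<Longrightarrow> in_Lp p M (\<lambda>\<omega>. 0)"
  by (simp add: in_Lp_def power_0_left)

lemma in_Lp_sum: "0 < p \<Longrightarrow> (\<And>i. i \<in> A \<Longrightarrow> in_Lp p M (f i)) \<Longrightarrow> in_Lp p M (\<lambda>\<omega>. \<Sum>i\<in>A. f i \<omega>)"
  by (induction A rule: infinite_finite_induct) (auto intro: in_Lp_add in_Lp_0)

text \<open>The product is dominated by the cube of the largest of the three absolute values, which
  avoids Hoelder's inequality.\<close>

lemma integrable_mult3_L3:
  assumes "in_Lp 3 M f" "in_Lp 3 M g" "in_Lp 3 M k"
  shows "integrable M (\<lambda>\<omega>. f \<omega> * g \<omega> * k \<omega>)"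
proof -
  note [measurable] = assms[unfolded in_Lp_def, THEN conjunct1]
  have "\<bar>x * y * z\<bar> \<le> \<bar>x\<bar> ^ 3 + \<bar>y\<bar> ^ 3 + \<bar>z\<bar> ^ 3" for x y z :: real
  proof -
    define m where "m = max \<bar>x\<bar> (max \<bar>y\<bar> \<bar>z\<bar>)"
    have "\<bar>x * y * z\<bar> \<le> m * m * m"
      unfolding abs_mult by (intro mult_mono mult_nonneg_nonneg) (auto simp: m_def)
    also have "\<dots> = m ^ 3" by (simp add: power3_eq_cube)
    also have "\<dots> \<le> \<bar>x\<bar> ^ 3 + \<bar>y\<bar> ^ 3 + \<bar>z\<bar> ^ 3" by (auto simp: m_def max_def)
    finally show ?thesis .
  qed
  then have ae: "AE \<omega> in M. norm (f \<omega> * g \<omega> * k \<omega>) \<le> norm (\<bar>f \<omega>\<bar> ^ 3 + \<bar>g \<omega>\<bar> ^ 3 + \<bar>k \<omega>\<bar> ^ 3)"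
    by (intro AE_I2) simp
  have i: "integrable M (\<lambda>\<omega>. \<bar>f \<omega>\<bar> ^ 3 + \<bar>g \<omega>\<bar> ^ 3 + \<bar>k \<omega>\<bar> ^ 3)"
    using assms by (simp add: in_Lp_def)
  show ?thesis
    by (rule Bochner_Integration.integrable_bound[OF i _ ae]) measurable
qed

text \<open>The p-th powers of the errors tend to 0 in L^1, hence almost everywhere along a
  subsequence; p-th roots give back the errors.\<close>

lemma sums_in_Lp_AE_subseq:
  assumes "sums_in_Lp p M f S" "0 < p"
  obtains \<phi> :: "nat \<Rightarrow> nat" where "strict_mono \<phi>" "AE \<omega> in M. (\<lambda>n. \<Sum>i<\<phi> n. f i \<omega>) \<longlonglongrightarrow> S \<omega>"
proof -
  have "in_Lp p M (\<lambda>\<omega>. (\<Sum>i<n. f i \<omega>) - S \<omega>)" for n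
    using assms by (intro in_Lp_diff in_Lp_sum) (auto simp: sums_in_Lp_def)
  then have "integrable M (\<lambda>\<omega>. \<bar>(\<Sum>i<n. f i \<omega>) - S \<omega>\<bar> ^ p)" for n
    by (simp add: in_Lp_def)
  from tendsto_L1_AE_subseq[of M "\<lambda>n \<omega>. \<bar>(\<Sum>i<n. f i \<omega>) - S \<omega>\<bar> ^ p", OF this]
  obtain \<phi> where \<phi>: "strict_mono \<phi>" "AE \<omega> in M. (\<lambda>n. \<bar>(\<Sum>i<\<phi> n. f i \<omega>) - S \<omega>\<bar> ^ p) \<longlonglongrightarrow> 0"
    using assms(1) by (auto simp: sums_in_Lp_def power_abs)
  show thesis
  proof (rule that[OF \<phi>(1)])
    show "AE \<omega> in M. (\<lambda>n. \<Sum>i<\<phi> n. f i \<omega>) \<longlonglongrightarrow> S \<omega>" using \<phi>(2)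
    proof eventually_elim
      case (elim \<omega>)
      then have "(\<lambda>n. root p (\<bar>(\<Sum>i<\<phi> n. f i \<omega>) - S \<omega>\<bar> ^ p)) \<longlonglongrightarrow> root p 0"
        by (intro tendsto_real_root)
      then have "(\<lambda>n. (\<Sum>i<\<phi> n. f i \<omega>) - S \<omega>) \<longlonglongrightarrow> 0"
        using assms(2) by (simp add: real_root_power_cancel tendsto_rabs_zero_iff)
      then show ?case by (simp add: LIM_zero_iff)
    qed
  qed
qed

text \<open>Fatou's lemma. It yields membership in L^p for an exponent other than the one in which
  the limit was taken, which is how the L^2 sums \<open>X\<close> acquire third moments.\<close>

lemma AE_limit_Lp_bound:
  fixes f :: "nat \<Rightarrow> 'a \<Rightarrow> real"
  assumes f: "\<And>n. in_Lp p M (f n)" and g: "g \<in> borel_measurable M"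
    and lim: "AE \<omega> in M. (\<lambda>n. f n \<omega>) \<longlonglongrightarrow> g \<omega>"
    and bd: "\<And>n. n0 \<le> n \<Longrightarrow> (\<integral>\<omega>. \<bar>f n \<omega>\<bar> ^ p \<partial>M) \<le> K" and K: "0 \<le> K"
  shows "in_Lp p M g" "(\<integral>\<omega>. \<bar>g \<omega>\<bar> ^ p \<partial>M) \<le> K"
proof -
  note [measurable] = f[unfolded in_Lp_def, THEN conjunct1] g
  have "(\<integral>\<^sup>+\<omega>. ennreal (\<bar>g \<omega>\<bar> ^ p) \<partial>M) = (\<integral>\<^sup>+\<omega>. liminf (\<lambda>n. ennreal (\<bar>f n \<omega>\<bar> ^ p)) \<partial>M)"
  proof (rule nn_integral_cong_AE)
    show "AE \<omega> in M. ennreal (\<bar>g \<omega>\<bar> ^ p) = liminf (\<lambda>n. ennreal (\<bar>f n \<omega>\<bar> ^ p))" using lim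
    proof eventually_elim
      case (elim \<omega>)
      then have "(\<lambda>n. ennreal (\<bar>f n \<omega>\<bar> ^ p)) \<longlonglongrightarrow> ennreal (\<bar>g \<omega>\<bar> ^ p)"
        by (intro tendsto_ennrealI tendsto_power tendsto_rabs)
      then show ?case by (rule lim_imp_Liminf[OF trivial_limit_sequentially, symmetric])
    qed
  qed
  also have "\<dots> \<le> liminf (\<lambda>n. \<integral>\<^sup>+\<omega>. ennreal (\<bar>f n \<omega>\<bar> ^ p) \<partial>M)"
    by (rule nn_integral_liminf) simp
  also have "\<dots> \<le> ennreal K"
  proof (rule Liminf_le)
    show "\<forall>\<^sub>F n in sequentially. (\<integral>\<^sup>+\<omega>. ennreal (\<bar>f n \<omega>\<bar> ^ p) \<partial>M) \<le> ennreal K"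
      using eventually_ge_at_top[of n0]
    proof eventually_elim
      case (elim n)
      then show ?case using bd[of n] f[of n] K
        by (subst nn_integral_eq_integral) (auto simp: in_Lp_def intro: ennreal_leI)
    qed
  qed simp
  finally have *: "(\<integral>\<^sup>+\<omega>. ennreal (\<bar>g \<omega>\<bar> ^ p) \<partial>M) \<le> ennreal K" .
  have i: "integrable M (\<lambda>\<omega>. \<bar>g \<omega>\<bar> ^ p)"
    using le_less_trans[OF *] by (intro integrableI_bounded) (auto simp: power_abs)
  then show "in_Lp p M g" by (simp add: in_Lp_def)
  show "(\<integral>\<omega>. \<bar>g \<omega>\<bar> ^ p \<partial>M) \<le> K"
    using * K by (subst (asm) nn_integral_eq_integral[OF i]) auto
qed

text \<open>The sums \<open>X\<close> and \<open>\<sigma>2\<close> of the model are only determined almost everywhere, so their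
  measurability with respect to the past can only be asserted for some version.\<close>

definition ae_measurable :: "'a measure \<Rightarrow> 'a measure \<Rightarrow> ('a \<Rightarrow> real) \<Rightarrow> bool" where
  "ae_measurable M G f \<longleftrightarrow>
     f \<in> borel_measurable M \<and> (\<exists>g\<in>borel_measurable G. AE \<omega> in M. f \<omega> = g \<omega>)"

lemma ae_measurableD: "ae_measurable M G f \<Longrightarrow> f \<in> borel_measurable M"
  by (simp add: ae_measurable_def)

lemma ae_measurable_compose:
  assumes "ae_measurable M G f" "\<phi> \<in> borel_measurable borel"
  shows "ae_measurable M G (\<lambda>\<omega>. \<phi> (f \<omega>))"
proof -
  obtain g where "f \<in> borel_measurable M" "g \<in> borel_measurable G" "AE \<omega> in M. f \<omega> = g \<omega>"
    using assms(1) by (auto simp: ae_measurable_def)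
  then show ?thesis using assms(2) unfolding ae_measurable_def
    by (intro conjI bexI[of _ "\<lambda>\<omega>. \<phi> (g \<omega>)"]) (auto intro: measurable_compose)
qed

lemma ae_measurable_const: "ae_measurable M G (\<lambda>\<omega>. k)"
  unfolding ae_measurable_def by (auto intro!: bexI[of _ "\<lambda>\<omega>. k"])

lemma ae_measurable_add:
  assumes "ae_measurable M G f" "ae_measurable M G g"
  shows "ae_measurable M G (\<lambda>\<omega>. f \<omega> + g \<omega>)"
proof -
  obtain f' g' where [measurable]: "f' \<in> borel_measurable G" "g' \<in> borel_measurable G"
    and ae: "AE \<omega> in M. f \<omega> = f' \<omega>" "AE \<omega> in M. g \<omega> = g' \<omega>"
    using assms unfolding ae_measurable_def by blast
  from ae have "AE \<omega> in M. f \<omega> + g \<omega> = f' \<omega> + g' \<omega>" by eventually_elim simp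
  moreover have "(\<lambda>\<omega>. f' \<omega> + g' \<omega>) \<in> borel_measurable G" by measurable
  moreover have "(\<lambda>\<omega>. f \<omega> + g \<omega>) \<in> borel_measurable M"
    using assms[THEN ae_measurableD] by measurable
  ultimately show ?thesis unfolding ae_measurable_def by (intro conjI bexI)
qed

lemma ae_measurable_mult:
  assumes "ae_measurable M G f" "ae_measurable M G g"
  shows "ae_measurable M G (\<lambda>\<omega>. f \<omega> * g \<omega>)"
proof -
  obtain f' g' where [measurable]: "f' \<in> borel_measurable G" "g' \<in> borel_measurable G"
    and ae: "AE \<omega> in M. f \<omega> = f' \<omega>" "AE \<omega> in M. g \<omega> = g' \<omega>"
    using assms unfolding ae_measurable_def by blast
  from ae have "AE \<omega> in M. f \<omega> * g \<omega> = f' \<omega> * g' \<omega>" by eventually_elim simp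
  moreover have "(\<lambda>\<omega>. f' \<omega> * g' \<omega>) \<in> borel_measurable G" by measurable
  moreover have "(\<lambda>\<omega>. f \<omega> * g \<omega>) \<in> borel_measurable M"
    using assms[THEN ae_measurableD] by measurable
  ultimately show ?thesis unfolding ae_measurable_def by (intro conjI bexI)
qed

lemma ae_measurable_sum:
  "(\<And>i. i \<in> A \<Longrightarrow> ae_measurable M G (f i)) \<Longrightarrow> ae_measurable M G (\<lambda>\<omega>. \<Sum>i\<in>A. f i \<omega>)"
  by (induction A rule: infinite_finite_induct) (auto intro: ae_measurable_const ae_measurable_add)

text \<open>Versions measurable for \<open>G\<close> are chosen for all members of the sequence;
  countably many null sets are discarded. The function \<open>lim\<close> of these versions is
  measurable even at points where no limit exists.\<close>

lemma ae_measurable_limit: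
  fixes f :: "nat \<Rightarrow> 'a \<Rightarrow> real"
  assumes f: "\<And>n. ae_measurable M G (f n)" and h: "h \<in> borel_measurable M"
    and lim: "AE \<omega> in M. (\<lambda>n. f n \<omega>) \<longlonglongrightarrow> h \<omega>"
  shows "ae_measurable M G h"
proof -
  obtain g where g[measurable]: "\<And>n. g n \<in> borel_measurable G" and fg: "\<And>n. AE \<omega> in M. f n \<omega> = g n \<omega>"
    using f unfolding ae_measurable_def by metis
  have "AE \<omega> in M. \<forall>n. f n \<omega> = g n \<omega>" using fg by (simp add: AE_all_countable)
  with lim have "AE \<omega> in M. h \<omega> = lim (\<lambda>n. g n \<omega>)"
    by eventually_elim (auto dest: limI)
  moreover have "(\<lambda>\<omega>. lim (\<lambda>n. g n \<omega>)) \<in> borel_measurable G" by measurable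
  ultimately show ?thesis using h unfolding ae_measurable_def by (intro conjI bexI)
qed

lemma ae_measurable_sums_in_Lp:
  assumes "sums_in_Lp p M f S" "0 < p" "\<And>n. ae_measurable M G (f n)"
  shows "ae_measurable M G S"
proof -
  obtain \<phi> where lim: "AE \<omega> in M. (\<lambda>n. \<Sum>i<\<phi> n. f i \<omega>) \<longlonglongrightarrow> S \<omega>"
    by (rule sums_in_Lp_AE_subseq[OF assms(1,2)])
  have S: "S \<in> borel_measurable M" using assms(1) by (simp add: sums_in_Lp_def in_Lp_def)
  show ?thesis by (rule ae_measurable_limit[OF ae_measurable_sum[OF assms(3)] S lim])
qed

section \<open>The filtration generated by the innovations\<close>

lemma space_generated_by_past [simp]: "space (generated_by_past M \<zeta> t) = space M"
  unfolding generated_by_past_def by (rule space_measure_of) auto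

lemma sets_generated_by_past:
  "sets (generated_by_past M \<zeta> t) =
     sigma_sets (space M) {\<zeta> s -` A \<inter> space M | s A. s \<le> t \<and> A \<in> sets borel}"
  unfolding generated_by_past_def by (rule sets_measure_of) auto

lemma sets_generated_by_past_mono:
  "s \<le> t \<Longrightarrow> sets (generated_by_past M \<zeta> s) \<subseteq> sets (generated_by_past M \<zeta> t)"
  unfolding sets_generated_by_past by (rule sigma_sets_mono') (blast intro: order_trans)

lemma ae_measurable_past_mono:
  assumes "ae_measurable M (generated_by_past M \<zeta> s) f" "s \<le> t"
  shows "ae_measurable M (generated_by_past M \<zeta> t) f"
proof -
  have "subalgebra (generated_by_past M \<zeta> t) (generated_by_past M \<zeta> s)"
    using sets_generated_by_past_mono[OF assms(2)] by (simp add: subalgebra_def)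
  then show ?thesis
    using assms(1) measurable_from_subalg unfolding ae_measurable_def by blast
qed

text \<open>For nonnegative terms the partial sums increase, so convergence along a subsequence is
  convergence of the whole series. This makes the series for \<open>\<sigma>2\<close> available
  pointwise.\<close>

lemma sums_in_Lp_nonneg_AE_sums:
  assumes "sums_in_Lp p M f S" "0 < p" "\<And>n \<omega>. 0 \<le> f n \<omega>"
  shows "AE \<omega> in M. (\<lambda>n. f n \<omega>) sums S \<omega>"
proof -
  obtain \<phi> where \<phi>: "strict_mono \<phi>" and lim: "AE \<omega> in M. (\<lambda>n. \<Sum>i<\<phi> n. f i \<omega>) \<longlonglongrightarrow> S \<omega>"
    by (rule sums_in_Lp_AE_subseq[OF assms(1,2)])
  from lim show ?thesis
  proof eventually_elim
    case (elim \<omega>)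
    have mono: "(\<Sum>i<m. f i \<omega>) \<le> (\<Sum>i<n. f i \<omega>)" if "m \<le> n" for m n
      using that assms(3) by (intro sum_mono2) auto
    have "incseq (\<lambda>n. \<Sum>i<\<phi> n. f i \<omega>)"
      using \<phi> by (intro incseq_SucI mono) (simp add: strict_mono_less_eq)
    then have "(\<Sum>i<\<phi> n. f i \<omega>) \<le> S \<omega>" for n using elim by (rule incseq_le)
    then have "(\<Sum>i<n. f i \<omega>) \<le> S \<omega>" for n
      using mono[OF seq_suble[OF \<phi>, of n]] order_trans by blast
    then have "summable (\<lambda>n. f n \<omega>)"
      using assms(3) by (intro summableI_nonneg_bounded)
    then obtain L where L: "(\<lambda>n. f n \<omega>) sums L" by (auto simp: summable_def)
    then have "(\<lambda>n. \<Sum>i<\<phi> n. f i \<omega>) \<longlonglongrightarrow> L"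
      using LIMSEQ_subseq_LIMSEQ[OF _ \<phi>] unfolding sums_def comp_def by blast
    with elim have "L = S \<omega>" by (rule LIMSEQ_unique[symmetric])
    with L show ?case by simp
  qed
qed

section \<open>Two cubic inequalities, and transfer of expectations by stationarity\<close>

lemma Young_cubic: "3 * x * y\<^sup>2 \<le> x ^ 3 + 2 * y ^ 3" if "0 \<le> x" "0 \<le> y" for x y :: real
proof -
  have "x ^ 3 + 2 * y ^ 3 - 3 * x * y\<^sup>2 = (x - y)\<^sup>2 * (x + 2 * y)"
    by (simp add: power2_eq_square power3_eq_cube algebra_simps)
  also have "0 \<le> \<dots>" using that by simp
  finally show ?thesis by simp
qed

text \<open>A second-order expansion of the cube of the absolute value in which the linear term
  keeps its sign, so that it can cancel in expectation when \<open>y\<close> is a martingale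
  difference.\<close>

lemma abs_add_cube_le:
  fixes x y :: real
  shows "\<bar>x + y\<bar> ^ 3 \<le> \<bar>x\<bar> ^ 3 + 3 * (x * \<bar>x\<bar>) * y + 3 * \<bar>x\<bar> * y\<^sup>2 + \<bar>y\<bar> ^ 3"
proof -
  have *: "\<bar>x + y\<bar> ^ 3 \<le> x ^ 3 + 3 * (x * x) * y + 3 * x * y\<^sup>2 + \<bar>y\<bar> ^ 3" if "0 \<le> x" for x y :: real
  proof -
    have e: "(x + y) ^ 3 = x ^ 3 + 3 * (x * x) * y + 3 * x * y\<^sup>2 + y ^ 3"
      by (simp add: power2_eq_square power3_eq_cube algebra_simps)
    consider "0 \<le> x + y" | "x + y < 0" by linarith
    then show ?thesis
    proof cases
      case 1
      have "y ^ 3 \<le> \<bar>y\<bar> ^ 3" by (metis abs_ge_self power_abs)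
      then show ?thesis using 1 e by simp
    next
      case 2
      \<comment> \<open>With x \<ge> 0 and x + y < 0 also y < 0, and the two sides differ by 2 x
        (x^2 + 3 x y + 3 y^2); completing the square shows that this is nonnegative.\<close>
      have "0 \<le> 2 * x * ((x + 3 / 2 * y)\<^sup>2 + 3 / 4 * y\<^sup>2)" using that by simp
      also have "\<dots> = 2 * (x ^ 3 + 3 * (x * x) * y + 3 * x * y\<^sup>2)"
        by (simp add: power2_eq_square power3_eq_cube algebra_simps)
      finally have "- (x ^ 3 + 3 * (x * x) * y + 3 * x * y\<^sup>2 + y ^ 3) \<le> x ^ 3 + 3 * (x * x) * y + 3 * x * y\<^sup>2 - y ^ 3"
        by simp
      moreover have "\<bar>y\<bar> ^ 3 = - (y ^ 3)" using 2 that by (simp add: abs_if)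
      moreover have "\<bar>x + y\<bar> ^ 3 = - ((x + y) ^ 3)"
        using 2 power_minus_odd[of 3 "x + y"] by (simp only: abs_of_neg) simp
      ultimately show ?thesis unfolding e by simp
    qed
  qed
  show ?thesis
  proof (cases "0 \<le> x")
    case True
    then show ?thesis using *[of x y] by simp
  next
    case False
    have "\<bar>- x + - y\<bar> = \<bar>x + y\<bar>" by linarith
    then show ?thesis using *[of "- x" "- y"] False by simp
  qed
qed

text \<open>Equality of the laws on the index set {s, t}, compared at shifts \<open>h\<close> and 0.
  The indices may coincide, so one-dimensional marginals are covered too. Integrability is
  transferred separately, as equal integrals alone would not give it.\<close>

lemma strictly_stationary_distr2:
  fixes \<phi> :: "real \<Rightarrow> real \<Rightarrow> real"
  assumes st: "strictly_stationary M u"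
    and \<phi>: "case_prod \<phi> \<in> borel_measurable (borel \<Otimes>\<^sub>M borel)"
  shows "integrable M (\<lambda>\<omega>. \<phi> (u (s + h) \<omega>) (u (t + h) \<omega>)) \<longleftrightarrow> integrable M (\<lambda>\<omega>. \<phi> (u s \<omega>) (u t \<omega>))"
    and "(\<integral>\<omega>. \<phi> (u (s + h) \<omega>) (u (t + h) \<omega>) \<partial>M) = (\<integral>\<omega>. \<phi> (u s \<omega>) (u t \<omega>) \<partial>M)"
proof -
  let ?N = "Pi\<^sub>M {s, t} (\<lambda>_. borel :: real measure)"
  let ?G = "\<lambda>h \<omega>. \<lambda>i\<in>{s, t}. u (i + h) \<omega>"
  have [measurable]: "u i \<in> borel_measurable M" for i using st by (simp add: strictly_stationary_def)
  have d: "distr M ?N (?G h) = distr M ?N (?G 0)"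
    using st unfolding strictly_stationary_def by simp
  have G: "?G h \<in> measurable M ?N" for h by measurable
  let ?F = "\<lambda>x. \<phi> (x s) (x t)"
  have "(\<lambda>x. (x s, x t)) \<in> measurable ?N (borel \<Otimes>\<^sub>M borel)" by measurable
  from measurable_compose[OF this \<phi>] have F: "?F \<in> borel_measurable ?N" by simp
  show "integrable M (\<lambda>\<omega>. \<phi> (u (s + h) \<omega>) (u (t + h) \<omega>)) \<longleftrightarrow> integrable M (\<lambda>\<omega>. \<phi> (u s \<omega>) (u t \<omega>))"
    using integrable_distr_eq[OF G[of h] F] integrable_distr_eq[OF G[of 0] F] unfolding d by simp
  show "(\<integral>\<omega>. \<phi> (u (s + h) \<omega>) (u (t + h) \<omega>) \<partial>M) = (\<integral>\<omega>. \<phi> (u s \<omega>) (u t \<omega>) \<partial>M)"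
    using integral_distr[OF G[of h] F] integral_distr[OF G[of 0] F] unfolding d by simp
qed

section \<open>Independence of innovations and past\<close>

context prob_space begin

text \<open>Independence gives E|UW| = E|U| E|W| in the extended nonnegative reals. The left side is
  finite and E|U| is not 0, so E|W| is finite. In this way moments of the volatility are recovered
  from moments of \<open>r\<close>.\<close>

lemma indep_var_integrable_factor:
  fixes U W :: "'a \<Rightarrow> real"
  assumes ind: "indep_var borel U borel W" and UW: "integrable M (\<lambda>\<omega>. U \<omega> * W \<omega>)"
    and nz: "\<not> (AE \<omega> in M. U \<omega> = 0)"
  shows "integrable M W"
proof -
  have [measurable]: "random_variable borel U" "random_variable borel W"
    using ind by (auto simp: indep_var_eq)
  let ?n = "\<lambda>x::real. ennreal \<bar>x\<bar>"
  have "indep_var borel (?n \<circ> U) borel (?n \<circ> W)"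
    by (rule indep_var_compose[OF ind]) auto
  then have iv: "indep_vars (\<lambda>_. borel) (case_bool (?n \<circ> U) (?n \<circ> W)) UNIV"
    unfolding indep_var_def by (simp add: case_bool_if)
  have "(\<integral>\<^sup>+\<omega>. ?n (U \<omega> * W \<omega>) \<partial>M) = (\<integral>\<^sup>+\<omega>. (\<Prod>i\<in>UNIV. case_bool (?n \<circ> U) (?n \<circ> W) i \<omega>) \<partial>M)"
    by (simp add: UNIV_bool abs_mult ennreal_mult mult.commute)
  also have "\<dots> = (\<Prod>i\<in>UNIV. \<integral>\<^sup>+\<omega>. case_bool (?n \<circ> U) (?n \<circ> W) i \<omega> \<partial>M)"
    by (rule indep_vars_nn_integral[OF _ iv]) auto
  also have "\<dots> = (\<integral>\<^sup>+\<omega>. ?n (U \<omega>) \<partial>M) * (\<integral>\<^sup>+\<omega>. ?n (W \<omega>) \<partial>M)"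
    by (simp add: UNIV_bool mult.commute comp_def)
  finally have eq: "(\<integral>\<^sup>+\<omega>. ?n (U \<omega> * W \<omega>) \<partial>M) = (\<integral>\<^sup>+\<omega>. ?n (U \<omega>) \<partial>M) * (\<integral>\<^sup>+\<omega>. ?n (W \<omega>) \<partial>M)" .
  have "(\<integral>\<^sup>+\<omega>. ?n (U \<omega>) \<partial>M) \<noteq> 0"
    using nz by (subst nn_integral_0_iff_AE) auto
  moreover have "(\<integral>\<^sup>+\<omega>. ?n (U \<omega> * W \<omega>) \<partial>M) < \<infinity>"
    using UW by (simp add: integrable_iff_bounded)
  ultimately have "(\<integral>\<^sup>+\<omega>. ?n (W \<omega>) \<partial>M) < \<infinity>"
    unfolding eq by (auto simp: ennreal_mult_less_top)
  then show ?thesis by (simp add: integrable_iff_bounded)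
qed

text \<open>The index blocks {t} and {..s} are disjoint, so the sigma-algebras they generate are
  independent; the second one is the past up to \<open>s\<close>.\<close>

lemma indep_var_future_past:
  fixes \<zeta> :: "int \<Rightarrow> 'a \<Rightarrow> real"
  assumes ind: "indep_vars (\<lambda>_. borel) \<zeta> UNIV" and "s < t"
    and W: "W \<in> borel_measurable (generated_by_past M \<zeta> s)"
  shows "indep_var borel (\<zeta> t) borel W"
proof -
  let ?E = "\<lambda>i. {\<zeta> i -` A \<inter> space M | A. A \<in> sets borel}"
  let ?I = "case_bool {t} {..s}"
  have \<zeta>[measurable]: "\<zeta> i \<in> borel_measurable M" for i
    using ind by (auto simp: indep_vars_def)
  have "indep_sets ?E UNIV" using ind by (simp add: indep_vars_def2)
  then have ie: "indep_sets ?E (\<Union>j\<in>UNIV. ?I j)" by (rule indep_sets_mono_index[rotated]) auto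
  have "indep_sets (\<lambda>j. sigma_sets (space M) (\<Union>i\<in>?I j. ?E i)) UNIV"
  proof (rule indep_sets_collect_sigma[OF ie])
    fix i show "Int_stable (?E i)"
      unfolding Int_stable_def
    proof clarify
      fix A B :: "real set" assume "A \<in> sets borel" "B \<in> sets borel"
      then show "\<exists>C. \<zeta> i -` A \<inter> space M \<inter> (\<zeta> i -` B \<inter> space M) = \<zeta> i -` C \<inter> space M \<and> C \<in> sets borel"
        by (intro exI[of _ "A \<inter> B"]) auto
    qed
    show "disjoint_family_on ?I UNIV"
      using \<open>s < t\<close> by (auto simp: disjoint_family_on_def split: bool.splits)
  qed
  then have ist: "indep_set (sigma_sets (space M) (?E t)) (sigma_sets (space M) (\<Union>i\<in>{..s}. ?E i))"
    unfolding indep_set_def by (rule indep_sets_cong[THEN iffD1, rotated 2]) (auto split: bool.splits)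
  have past: "sigma_sets (space M) (\<Union>i\<in>{..s}. ?E i) = sets (generated_by_past M \<zeta> s)"
    unfolding sets_generated_by_past by (rule arg_cong[where f="sigma_sets (space M)"]) auto
  have sub: "sets (generated_by_past M \<zeta> s) \<subseteq> events"
    using ist past by (auto simp: indep_set_def indep_sets_def split: bool.splits)
  have "sigma_sets (space M) {W -` A \<inter> space M | A. A \<in> sets borel} \<subseteq> sets (generated_by_past M \<zeta> s)"
  proof -
    have "{W -` A \<inter> space M | A. A \<in> sets borel} \<subseteq> sets (generated_by_past M \<zeta> s)"
      using W by (auto simp: measurable_def)
    then show ?thesis using sets.sigma_sets_subset[of _ "generated_by_past M \<zeta> s"] by simp
  qed
  with ist have "indep_set (sigma_sets (space M) (?E t))
      (sigma_sets (space M) {W -` A \<inter> space M | A. A \<in> sets borel})"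
    unfolding past indep_sets2_eq by blast
  moreover have "random_variable borel W" using W sub by (auto simp: measurable_def)
  ultimately show ?thesis unfolding indep_var_eq using \<zeta> by auto
qed

text \<open>Used with \<open>g\<close> the first, second and third power, this replaces conditional
  expectations given the past. Integrability of \<open>W\<close> is a conclusion: only that of the
  product is known beforehand.\<close>

lemma integral_innovation_mult_past:
  fixes \<zeta> :: "int \<Rightarrow> 'a \<Rightarrow> real" and g :: "real \<Rightarrow> real"
  assumes ind: "indep_vars (\<lambda>_. borel) \<zeta> UNIV" and "s < t"
    and W: "ae_measurable M (generated_by_past M \<zeta> s) W"
    and g[measurable]: "g \<in> borel_measurable borel"
    and U: "integrable M (\<lambda>\<omega>. g (\<zeta> t \<omega>))" "\<not> (AE \<omega> in M. g (\<zeta> t \<omega>) = 0)"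
    and UW: "integrable M (\<lambda>\<omega>. g (\<zeta> t \<omega>) * W \<omega>)"
  shows "integrable M W"
    and "expectation (\<lambda>\<omega>. g (\<zeta> t \<omega>) * W \<omega>) = expectation (\<lambda>\<omega>. g (\<zeta> t \<omega>)) * expectation W"
proof -
  have \<zeta>[measurable]: "\<zeta> i \<in> borel_measurable M" for i
    using ind by (auto simp: indep_vars_def)
  obtain W' where W': "W' \<in> borel_measurable (generated_by_past M \<zeta> s)" "AE \<omega> in M. W \<omega> = W' \<omega>"
    using W by (auto simp: ae_measurable_def)
  have iv: "indep_var borel (\<lambda>\<omega>. g (\<zeta> t \<omega>)) borel W'"
    using indep_var_compose[OF indep_var_future_past[OF ind \<open>s < t\<close> W'(1)] g measurable_ident]
    by (simp add: comp_def)
  have [measurable]: "W \<in> borel_measurable M" "W' \<in> borel_measurable M"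
    using W iv by (auto simp: ae_measurable_def indep_var_eq)
  have AE: "AE \<omega> in M. g (\<zeta> t \<omega>) * W \<omega> = g (\<zeta> t \<omega>) * W' \<omega>" using W'(2) by auto
  have "integrable M (\<lambda>\<omega>. g (\<zeta> t \<omega>) * W' \<omega>)"
    using UW integrable_cong_AE[OF _ _ AE] by simp
  then have iW': "integrable M W'" by (rule indep_var_integrable_factor[OF iv _ U(2)])
  then show "integrable M W" using integrable_cong_AE[OF _ _ W'(2)] by simp
  show "expectation (\<lambda>\<omega>. g (\<zeta> t \<omega>) * W \<omega>) = expectation (\<lambda>\<omega>. g (\<zeta> t \<omega>)) * expectation W"
    using indep_var_lebesgue_integral[OF iv U(1) iW']
      integral_cong_AE[OF _ _ AE] integral_cong_AE[OF _ _ W'(2)] by simp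
qed

end

section \<open>Martingale difference properties of the solution\<close>

text \<open>\<open>X\<close> and \<open>\<sigma>2\<close> are one fixed choice of the versions whose
  existence \<open>L2_solution\<close> asserts; identities for them below hold almost everywhere for
  this choice.\<close>

locale leverage_model = prob_space M for M :: "'a measure" +
  fixes \<zeta> r X \<sigma>2 :: "int \<Rightarrow> 'a \<Rightarrow> real" and \<gamma> a c :: real and b :: "nat \<Rightarrow> real"
  assumes \<gamma>: "0 \<le> \<gamma>" "\<gamma> < 1" and a: "a \<noteq> 0"
    and \<zeta>_indep: "indep_vars (\<lambda>_. borel) \<zeta> UNIV"
    and \<zeta>_distr: "\<And>t. distr M borel (\<zeta> t) = distr M borel (\<zeta> 0)"
    and \<zeta>_sq: "integrable M (\<lambda>\<omega>. (\<zeta> 0 \<omega>)\<^sup>2)"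
    and \<zeta>_mean: "expectation (\<zeta> 0) = 0"
    and \<zeta>_var: "variance (\<zeta> 0) = 1"
    and \<zeta>_L3: "integrable M (\<lambda>\<omega>. \<bar>\<zeta> 0 \<omega>\<bar> ^ 3)"
    and \<zeta>_third: "expectation (\<lambda>\<omega>. \<zeta> 0 \<omega> ^ 3) = 0"
    and r_adapted: "adapted_to (generated_by_past M \<zeta>) r"
    and X_sums: "\<And>t. sums_in_Lp 2 M (\<lambda>j \<omega>. b (Suc j) * r (t - int (Suc j)) \<omega>) (X t)"
    and \<sigma>2_sums: "\<And>t. sums_in_Lp 1 M (\<lambda>l \<omega>. \<gamma> ^ l * (c\<^sup>2 + (a + X (t - int l) \<omega>)\<^sup>2)) (\<sigma>2 t)"
    and r_eq: "\<And>t. AE \<omega> in M. r t \<omega> = \<zeta> t \<omega> * sqrt (\<sigma>2 t \<omega>)"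
    and r_stat: "strictly_stationary M r"
    and r_L3: "integrable M (\<lambda>\<omega>. \<bar>r 0 \<omega>\<bar> ^ 3)"
    and b_sq: "summable (\<lambda>j. (b (Suc j))\<^sup>2)"
begin

section \<open>Notation and moments of the innovations\<close>

abbreviation past :: "int \<Rightarrow> ('a \<Rightarrow> real) \<Rightarrow> bool" where
  "past t \<equiv> ae_measurable M (generated_by_past M \<zeta> t)"

abbreviation L3 :: "('a \<Rightarrow> real) \<Rightarrow> bool" where
  "L3 \<equiv> in_Lp 3 M"

lemma \<zeta>_measurable [measurable]: "\<zeta> t \<in> borel_measurable M"
  using \<zeta>_indep by (simp add: indep_vars_def)

lemma \<zeta>_transfer:
  fixes g :: "real \<Rightarrow> real"
  assumes [measurable]: "g \<in> borel_measurable borel"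
  shows "integrable M (\<lambda>\<omega>. g (\<zeta> t \<omega>)) \<longleftrightarrow> integrable M (\<lambda>\<omega>. g (\<zeta> 0 \<omega>))"
    and "expectation (\<lambda>\<omega>. g (\<zeta> t \<omega>)) = expectation (\<lambda>\<omega>. g (\<zeta> 0 \<omega>))"
  using integrable_distr_eq[OF \<zeta>_measurable assms, of t] integrable_distr_eq[OF \<zeta>_measurable assms, of 0]
    integral_distr[OF \<zeta>_measurable assms, of t] integral_distr[OF \<zeta>_measurable assms, of 0]
  unfolding \<zeta>_distr[of t] by (blast, metis)

lemma \<zeta>_moments:
  shows "integrable M (\<zeta> t)" "expectation (\<zeta> t) = 0"
    and "integrable M (\<lambda>\<omega>. (\<zeta> t \<omega>)\<^sup>2)" "expectation (\<lambda>\<omega>. (\<zeta> t \<omega>)\<^sup>2) = 1"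
    and "integrable M (\<lambda>\<omega>. (\<zeta> t \<omega>) ^ 3)" "expectation (\<lambda>\<omega>. (\<zeta> t \<omega>) ^ 3) = 0"
proof -
  have "integrable M (\<zeta> 0)" by (rule square_integrable_imp_integrable[OF _ \<zeta>_sq]) simp
  then show "integrable M (\<zeta> t)" by (subst \<zeta>_transfer(1)) simp_all
  show "expectation (\<zeta> t) = 0" by (subst \<zeta>_transfer(2)) (simp_all add: \<zeta>_mean)
  show "integrable M (\<lambda>\<omega>. (\<zeta> t \<omega>)\<^sup>2)" "expectation (\<lambda>\<omega>. (\<zeta> t \<omega>)\<^sup>2) = 1"
    using \<zeta>_transfer[of "\<lambda>x. x\<^sup>2" t] \<zeta>_sq \<zeta>_var by (simp_all add: \<zeta>_mean)
  have "integrable M (\<lambda>\<omega>. (\<zeta> 0 \<omega>) ^ 3)"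
    using \<zeta>_L3 by (subst integrable_abs_iff[symmetric]) (auto simp: power_abs)
  then show "integrable M (\<lambda>\<omega>. (\<zeta> t \<omega>) ^ 3)" "expectation (\<lambda>\<omega>. (\<zeta> t \<omega>) ^ 3) = 0"
    using \<zeta>_transfer[of "\<lambda>x. x ^ 3" t] \<zeta>_third by simp_all
qed

text \<open>Unit variance gives the nondegeneracy needed to divide out an innovation factor.\<close>

lemma \<zeta>_power_nonzero: "\<not> (AE \<omega> in M. \<zeta> t \<omega> ^ n = 0)"
proof
  assume "AE \<omega> in M. \<zeta> t \<omega> ^ n = 0"
  then have "AE \<omega> in M. (\<zeta> t \<omega>)\<^sup>2 = 0" by eventually_elim (simp add: power_0_left split: if_splits)
  then have "expectation (\<lambda>\<omega>. (\<zeta> t \<omega>)\<^sup>2) = 0" by (rule integral_eq_zero_AE)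
  then show False by (simp add: \<zeta>_moments)
qed

definition C :: real where "C = expectation (\<lambda>\<omega>. \<bar>r 0 \<omega>\<bar> ^ 3)"

lemma C_nonneg: "0 \<le> C" unfolding C_def by simp

lemma r_measurable [measurable]: "r t \<in> borel_measurable M"
  using r_stat by (simp add: strictly_stationary_def)

lemma r_in_L3: "L3 (r t)" and r_third_moment: "expectation (\<lambda>\<omega>. \<bar>r t \<omega>\<bar> ^ 3) = C"
  using strictly_stationary_distr2[OF r_stat, of "\<lambda>x y. \<bar>x\<bar> ^ 3" 0 t 0] r_L3
  by (simp_all add: in_Lp_def C_def)

lemma L3_one: "L3 (\<lambda>\<omega>. 1)"
  by (simp add: in_Lp_def)

lemma L3_integrable2: "L3 f \<Longrightarrow> L3 g \<Longrightarrow> integrable M (\<lambda>\<omega>. f \<omega> * g \<omega>)"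
  using integrable_mult3_L3[OF _ _ L3_one] by simp

lemma L3_integrable1: "L3 f \<Longrightarrow> integrable M f"
  using L3_integrable2[OF _ L3_one] by simp

lemma L3_integrable_sq_mult: "L3 f \<Longrightarrow> L3 g \<Longrightarrow> integrable M (\<lambda>\<omega>. (f \<omega>)\<^sup>2 * g \<omega>)"
  using integrable_mult3_L3[of M f f g] by (simp add: power2_eq_square)

lemma r_past: "s \<le> t \<Longrightarrow> past t (r s)"
proof (rule ae_measurable_past_mono)
  show "past s (r s)"
    using r_adapted r_measurable unfolding ae_measurable_def adapted_to_def by auto
qed

text \<open>The part of \<open>X t\<close> with lags greater than \<open>N\<close>, that is, times
  up to t - N - 1. It is defined by subtraction because \<open>X t\<close> is only given as a limit
  in L^2.\<close>

definition X_tail :: "int \<Rightarrow> nat \<Rightarrow> 'a \<Rightarrow> real" where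
  "X_tail t N \<omega> = X t \<omega> - (\<Sum>j<N. b (Suc j) * r (t - int (Suc j)) \<omega>)"

lemma X_measurable [measurable]: "X t \<in> borel_measurable M"
  using X_sums[of t] by (simp add: sums_in_Lp_def in_Lp_def)

lemma X_tail_measurable [measurable]: "X_tail t N \<in> borel_measurable M"
  unfolding X_tail_def by measurable

text \<open>The subsequence starts late enough that its indices are at least \<open>N\<close>, so
  each partial sum minus the first \<open>N\<close> terms is a sum over an interval.\<close>

lemma X_tail_AE_limit:
  obtains \<psi> where "\<And>n. N \<le> \<psi> n"
    and "AE \<omega> in M. (\<lambda>n. \<Sum>j\<in>{N..<\<psi> n}. b (Suc j) * r (t - int (Suc j)) \<omega>) \<longlonglongrightarrow> X_tail t N \<omega>"
proof -
  obtain \<phi> where \<phi>: "strict_mono \<phi>"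
    and lim: "AE \<omega> in M. (\<lambda>n. \<Sum>j<\<phi> n. b (Suc j) * r (t - int (Suc j)) \<omega>) \<longlonglongrightarrow> X t \<omega>"
    by (rule sums_in_Lp_AE_subseq[OF X_sums]) auto
  have N: "N \<le> \<phi> (n + N)" for n using seq_suble[OF \<phi>, of "n + N"] by simp
  show thesis
  proof (rule that[of "\<lambda>n. \<phi> (n + N)", OF N])
    show "AE \<omega> in M. (\<lambda>n. \<Sum>j\<in>{N..<\<phi> (n + N)}. b (Suc j) * r (t - int (Suc j)) \<omega>) \<longlonglongrightarrow> X_tail t N \<omega>"
      using lim
    proof eventually_elim
      case (elim \<omega>)
      let ?g = "\<lambda>j. b (Suc j) * r (t - int (Suc j)) \<omega>"
      have "(\<lambda>n. (\<Sum>j<\<phi> (n + N). ?g j) - (\<Sum>j<N. ?g j)) \<longlonglongrightarrow> X_tail t N \<omega>"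
        unfolding X_tail_def by (intro tendsto_diff tendsto_const LIMSEQ_ignore_initial_segment elim)
      moreover have "(\<Sum>j<\<phi> (n + N). ?g j) - (\<Sum>j<N. ?g j) = (\<Sum>j\<in>{N..<\<phi> (n + N)}. ?g j)" for n
        using sum_diff_nat_ivl[of 0 N "\<phi> (n + N)" ?g] N[of n] by (simp add: atLeast0LessThan)
      ultimately show ?case by simp
    qed
  qed
qed

lemma X_tail_past: "past s (X_tail t N)" if "t - int N \<le> s + 1"
proof -
  obtain \<psi> where lim: "AE \<omega> in M. (\<lambda>n. \<Sum>j\<in>{N..<\<psi> n}. b (Suc j) * r (t - int (Suc j)) \<omega>) \<longlonglongrightarrow> X_tail t N \<omega>"
    by (rule X_tail_AE_limit)
  have "past s (\<lambda>\<omega>. \<Sum>j\<in>{N..<\<psi> n}. b (Suc j) * r (t - int (Suc j)) \<omega>)" for n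
    using that by (intro ae_measurable_sum ae_measurable_mult ae_measurable_const r_past) auto
  then show ?thesis by (rule ae_measurable_limit[OF _ X_tail_measurable lim])
qed

lemma X_past: "t \<le> s + 1 \<Longrightarrow> past s (X t)"
  using X_tail_past[of t 0 s] by (simp add: X_tail_def [abs_def])

lemma \<sigma>2_past: "past (t - 1) (\<sigma>2 t)"
proof (rule ae_measurable_sums_in_Lp[OF \<sigma>2_sums])
  fix l
  show "past (t - 1) (\<lambda>\<omega>. \<gamma> ^ l * (c\<^sup>2 + (a + X (t - int l) \<omega>)\<^sup>2))"
    using ae_measurable_compose[OF X_past, of "t - int l" "t - 1" "\<lambda>x. \<gamma> ^ l * (c\<^sup>2 + (a + x)\<^sup>2)"] by simp
qed simp

lemma \<sigma>2_AE_sums: "AE \<omega> in M. (\<lambda>l. \<gamma> ^ l * (c\<^sup>2 + (a + X (t - int l) \<omega>)\<^sup>2)) sums \<sigma>2 t \<omega>"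
  by (rule sums_in_Lp_nonneg_AE_sums[OF \<sigma>2_sums]) (use \<gamma> in auto)

lemma \<sigma>2_lower: "AE \<omega> in M. (a + X t \<omega>)\<^sup>2 \<le> \<sigma>2 t \<omega>"
  using \<sigma>2_AE_sums[of t]
proof eventually_elim
  case (elim \<omega>)
  let ?q = "\<lambda>l. \<gamma> ^ l * (c\<^sup>2 + (a + X (t - int l) \<omega>)\<^sup>2)"
  have "(\<Sum>l\<in>{0}. ?q l) \<le> \<sigma>2 t \<omega>"
    using sum_le_suminf[of ?q "{0}"] elim \<gamma> by (auto simp: sums_iff)
  then have "c\<^sup>2 + (a + X t \<omega>)\<^sup>2 \<le> \<sigma>2 t \<omega>" by simp
  then show ?case using zero_le_power2[of c] by linarith
qed

lemma \<sigma>2_nonneg: "AE \<omega> in M. 0 \<le> \<sigma>2 t \<omega>"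
  using \<sigma>2_lower[of t] by eventually_elim (rule order_trans[OF zero_le_power2])

text \<open>Splitting off the term l = 0 leaves \<open>\<gamma>\<close> times the series at time t -
  1, since the weights are geometric.\<close>

lemma \<sigma>2_recursion: "AE \<omega> in M. \<sigma>2 t \<omega> = \<gamma> * \<sigma>2 (t - 1) \<omega> + (c\<^sup>2 + (a + X t \<omega>)\<^sup>2)"
  using \<sigma>2_AE_sums[of t] \<sigma>2_AE_sums[of "t - 1"]
proof eventually_elim
  case (elim \<omega>)
  let ?q = "\<lambda>l. \<gamma> ^ l * (c\<^sup>2 + (a + X (t - int l) \<omega>)\<^sup>2)"
  have "(\<lambda>l. \<gamma> * (\<gamma> ^ l * (c\<^sup>2 + (a + X (t - 1 - int l) \<omega>)\<^sup>2))) sums (\<gamma> * \<sigma>2 (t - 1) \<omega>)"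
    using elim(2) by (rule sums_mult)
  then have "(\<lambda>l. ?q (Suc l)) sums (\<gamma> * \<sigma>2 (t - 1) \<omega>)"
    by (simp add: algebra_simps)
  then have "?q sums (\<gamma> * \<sigma>2 (t - 1) \<omega> + ?q 0)" by (rule sums_Suc)
  with elim(1) show ?case using sums_unique2 by fastforce
qed

lemma \<sigma>2_measurable [measurable]: "\<sigma>2 t \<in> borel_measurable M"
  using \<sigma>2_past by (rule ae_measurableD)

text \<open>The martingale difference property: \<open>r t\<close> is the centred
  \<open>\<zeta> t\<close> times a factor known at time t - 1.\<close>

lemma integral_r_mult_past:
  assumes V: "past s V" "s < t" and i: "integrable M (\<lambda>\<omega>. r t \<omega> * V \<omega>)"
  shows "expectation (\<lambda>\<omega>. r t \<omega> * V \<omega>) = 0"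
proof -
  let ?W = "\<lambda>\<omega>. sqrt (\<sigma>2 t \<omega>) * V \<omega>"
  have [measurable]: "V \<in> borel_measurable M" using V(1) by (rule ae_measurableD)
  have W: "past (t - 1) ?W"
    using ae_measurable_past_mono[OF V(1), of "t - 1"] V(2)
    by (intro ae_measurable_mult ae_measurable_compose[OF \<sigma>2_past]) auto
  have eq: "AE \<omega> in M. r t \<omega> * V \<omega> = \<zeta> t \<omega> * ?W \<omega>"
    using r_eq[of t] by eventually_elim simp
  have "integrable M (\<lambda>\<omega>. \<zeta> t \<omega> * ?W \<omega>)"
    using i integrable_cong_AE[OF _ _ eq] by simp
  then have "expectation (\<lambda>\<omega>. \<zeta> t \<omega> * ?W \<omega>) = expectation (\<zeta> t) * expectation ?W"
    by (intro integral_innovation_mult_past(2)[OF \<zeta>_indep _ W, where g="\<lambda>x. x"])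
       (use \<zeta>_moments \<zeta>_power_nonzero[of t 1] in auto)
  then show ?thesis using integral_cong_AE[OF _ _ eq] by (simp add: \<zeta>_moments)
qed

text \<open>\<open>\<sigma>2 t\<close> is the conditional variance of \<open>r t\<close>, because
  the square of \<open>\<zeta> t\<close> has mean 1 and is independent of the past.\<close>

lemma integral_r_sq_mult_past:
  assumes V: "past s V" "s < t" and i: "integrable M (\<lambda>\<omega>. (r t \<omega>)\<^sup>2 * V \<omega>)"
  shows "integrable M (\<lambda>\<omega>. \<sigma>2 t \<omega> * V \<omega>)"
    and "expectation (\<lambda>\<omega>. (r t \<omega>)\<^sup>2 * V \<omega>) = expectation (\<lambda>\<omega>. \<sigma>2 t \<omega> * V \<omega>)"
proof -
  let ?W = "\<lambda>\<omega>. \<sigma>2 t \<omega> * V \<omega>"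
  have [measurable]: "V \<in> borel_measurable M" using V(1) by (rule ae_measurableD)
  have W: "past (t - 1) ?W"
    using ae_measurable_past_mono[OF V(1), of "t - 1"] V(2)
    by (intro ae_measurable_mult \<sigma>2_past) auto
  have eq: "AE \<omega> in M. (r t \<omega>)\<^sup>2 * V \<omega> = (\<zeta> t \<omega>)\<^sup>2 * ?W \<omega>"
    using r_eq[of t] \<sigma>2_nonneg[of t] by eventually_elim (simp add: power_mult_distrib)
  have iW: "integrable M (\<lambda>\<omega>. (\<zeta> t \<omega>)\<^sup>2 * ?W \<omega>)"
    using i integrable_cong_AE[OF _ _ eq] by simp
  have *: "t - 1 < t" "(\<lambda>x::real. x\<^sup>2) \<in> borel_measurable borel" by auto
  note L = integral_innovation_mult_past[OF \<zeta>_indep *(1) W *(2) \<zeta>_moments(3) \<zeta>_power_nonzero iW]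
  show "integrable M ?W" by (rule L(1))
  show "expectation (\<lambda>\<omega>. (r t \<omega>)\<^sup>2 * V \<omega>) = expectation ?W"
    using L(2) integral_cong_AE[OF _ _ eq] by (simp add: \<zeta>_moments)
qed

text \<open>Both variables are \<open>?W\<close>, the cube of the volatility, times an odd power of
  \<open>\<zeta> t\<close>: the third power for the cube of \<open>r t\<close>, the first for
  \<open>\<sigma>2 t * r t\<close>. Both powers have mean 0, the third by hypothesis. Together they
  supply the initial value of the recursion.\<close>

lemma r_cubed_\<sigma>2:
  shows "expectation (\<lambda>\<omega>. r t \<omega> ^ 3) = 0"
    and "integrable M (\<lambda>\<omega>. \<sigma>2 t \<omega> * r t \<omega>)" "expectation (\<lambda>\<omega>. \<sigma>2 t \<omega> * r t \<omega>) = 0"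
proof -
  let ?W = "\<lambda>\<omega>. \<sigma>2 t \<omega> * sqrt (\<sigma>2 t \<omega>)"
  have W: "past (t - 1) ?W"
    by (intro ae_measurable_mult ae_measurable_compose[OF \<sigma>2_past] \<sigma>2_past) auto
  have eq: "AE \<omega> in M. r t \<omega> ^ 3 = \<zeta> t \<omega> ^ 3 * ?W \<omega>"
    using r_eq[of t] \<sigma>2_nonneg[of t]
    by eventually_elim (simp add: power_mult_distrib power3_eq_cube)
  have i3: "integrable M (\<lambda>\<omega>. r t \<omega> ^ 3)"
    using integrable_mult3_L3[OF r_in_L3 r_in_L3 r_in_L3] by (simp add: power3_eq_cube)
  have iW: "integrable M (\<lambda>\<omega>. \<zeta> t \<omega> ^ 3 * ?W \<omega>)"
    using i3 integrable_cong_AE[OF _ _ eq] by simp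
  have *: "t - 1 < t" "(\<lambda>x::real. x ^ 3) \<in> borel_measurable borel" by auto
  note L = integral_innovation_mult_past[OF \<zeta>_indep *(1) W *(2) \<zeta>_moments(5) \<zeta>_power_nonzero iW]
  show "expectation (\<lambda>\<omega>. r t \<omega> ^ 3) = 0"
    using L(2) integral_cong_AE[OF _ _ eq] by (simp add: \<zeta>_moments)
  have eq2: "AE \<omega> in M. \<zeta> t \<omega> * ?W \<omega> = \<sigma>2 t \<omega> * r t \<omega>"
    using r_eq[of t] by eventually_elim simp
  have i1: "integrable M (\<lambda>\<omega>. \<zeta> t \<omega> * ?W \<omega>)"
  proof (rule Bochner_Integration.integrable_bound)
    show "integrable M (\<lambda>\<omega>. ?W \<omega> + \<bar>\<zeta> t \<omega> ^ 3 * ?W \<omega>\<bar>)" using L(1) iW by simp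
    \<comment> \<open>From |z| \<le> 1 + |z|^3: the first moment in \<open>\<zeta> t\<close> is
      dominated by \<open>?W\<close>, integrable by independence, and by the known third-order
      term.\<close>
    have "\<bar>z * w\<bar> \<le> w + \<bar>z ^ 3 * w\<bar>" if "0 \<le> w" for z w :: real
    proof -
      have "\<bar>z\<bar> \<le> 1 + \<bar>z\<bar> ^ 3"
        using power_increasing[of 1 3 "\<bar>z\<bar>"] by (cases "1 \<le> \<bar>z\<bar>") (auto intro: order_trans[of _ 1])
      then have "\<bar>z\<bar> * w \<le> (1 + \<bar>z\<bar> ^ 3) * w" using that by (rule mult_right_mono)
      then show ?thesis using that by (simp add: abs_mult power_abs distrib_right)
    qed
    then have "\<bar>z * w\<bar> \<le> \<bar>w + \<bar>z ^ 3 * w\<bar>\<bar>" if "0 \<le> w" for z w :: real using that by fastforce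
    then show "AE \<omega> in M. norm (\<zeta> t \<omega> * ?W \<omega>) \<le> norm (?W \<omega> + \<bar>\<zeta> t \<omega> ^ 3 * ?W \<omega>\<bar>)"
      using \<sigma>2_nonneg[of t] by (auto elim!: eventually_mono simp del: abs_mult)
  qed simp
  have "expectation (\<lambda>\<omega>. \<zeta> t \<omega> * ?W \<omega>) = expectation (\<zeta> t) * expectation ?W"
    using integral_innovation_mult_past(2)[OF \<zeta>_indep *(1) W _ _ _ i1] \<zeta>_moments(1)[of t] \<zeta>_power_nonzero[of t 1]
    by simp
  then show "expectation (\<lambda>\<omega>. \<sigma>2 t \<omega> * r t \<omega>) = 0"
    using integral_cong_AE[OF _ _ eq2] by (simp add: \<zeta>_moments)
  show "integrable M (\<lambda>\<omega>. \<sigma>2 t \<omega> * r t \<omega>)"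
    using i1 integrable_cong_AE[OF _ _ eq2] by simp
qed

section \<open>Third moments and square summability of the leverage function\<close>

text \<open>The linear term has mean 0 and Young's inequality bounds the rest by k^2 (E|V|^3 + 3 C).
  The summand 3 C on both sides turns this into a multiplicative estimate that can be
  iterated.\<close>

lemma third_moment_step:
  assumes V: "past s V" "s < t" "L3 V" and k: "\<bar>k\<bar> \<le> 1"
  shows "expectation (\<lambda>\<omega>. \<bar>V \<omega> + k * r t \<omega>\<bar> ^ 3) + 3 * C
    \<le> (expectation (\<lambda>\<omega>. \<bar>V \<omega>\<bar> ^ 3) + 3 * C) * (1 + k\<^sup>2)"
proof -
  note [measurable] = ae_measurableD[OF V(1)]
  have absV: "L3 (\<lambda>\<omega>. \<bar>V \<omega>\<bar>)" using V(3) by (simp add: in_Lp_def)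
  have pt: "\<bar>x + k * y\<bar> ^ 3 \<le> \<bar>x\<bar> ^ 3 + 3 * k * (y * (x * \<bar>x\<bar>)) + k\<^sup>2 * (\<bar>x\<bar> ^ 3 + 2 * \<bar>y\<bar> ^ 3) + k\<^sup>2 * \<bar>y\<bar> ^ 3"
    for x y :: real
  proof -
    have "3 * \<bar>x\<bar> * (k * y)\<^sup>2 = k\<^sup>2 * (3 * \<bar>x\<bar> * \<bar>y\<bar>\<^sup>2)" by (simp add: power_mult_distrib)
    also have "\<dots> \<le> k\<^sup>2 * (\<bar>x\<bar> ^ 3 + 2 * \<bar>y\<bar> ^ 3)" by (intro mult_left_mono Young_cubic) auto
    finally have 1: "3 * \<bar>x\<bar> * (k * y)\<^sup>2 \<le> k\<^sup>2 * (\<bar>x\<bar> ^ 3 + 2 * \<bar>y\<bar> ^ 3)" .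
    have "\<bar>k\<bar> ^ 3 \<le> \<bar>k\<bar>\<^sup>2" using k by (intro power_decreasing) auto
    then have "\<bar>k * y\<bar> ^ 3 \<le> k\<^sup>2 * \<bar>y\<bar> ^ 3"
      unfolding abs_mult power_mult_distrib by (intro mult_right_mono) auto
    with 1 abs_add_cube_le[of x "k * y"] show ?thesis by (simp add: mult_ac)
  qed
  have i1: "integrable M (\<lambda>\<omega>. r t \<omega> * (V \<omega> * \<bar>V \<omega>\<bar>))"
    using integrable_mult3_L3[OF r_in_L3 V(3) absV] by (simp add: mult.assoc)
  have E1: "expectation (\<lambda>\<omega>. r t \<omega> * (V \<omega> * \<bar>V \<omega>\<bar>)) = 0"
    by (rule integral_r_mult_past[OF _ V(2) i1])
       (intro ae_measurable_mult V(1) ae_measurable_compose[OF V(1), of abs], simp)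
  have iV: "integrable M (\<lambda>\<omega>. \<bar>V \<omega>\<bar> ^ 3)" "integrable M (\<lambda>\<omega>. \<bar>r t \<omega>\<bar> ^ 3)"
    using V(3) r_in_L3[of t] by (simp_all add: in_Lp_def)
  have "expectation (\<lambda>\<omega>. \<bar>V \<omega> + k * r t \<omega>\<bar> ^ 3) \<le>
      expectation (\<lambda>\<omega>. \<bar>V \<omega>\<bar> ^ 3 + 3 * k * (r t \<omega> * (V \<omega> * \<bar>V \<omega>\<bar>))
        + k\<^sup>2 * (\<bar>V \<omega>\<bar> ^ 3 + 2 * \<bar>r t \<omega>\<bar> ^ 3) + k\<^sup>2 * \<bar>r t \<omega>\<bar> ^ 3)"
  proof (rule integral_mono)
    show "integrable M (\<lambda>\<omega>. \<bar>V \<omega> + k * r t \<omega>\<bar> ^ 3)"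
      using in_Lp_add[OF V(3) in_Lp_cmult[OF r_in_L3, of k t]] by (simp add: in_Lp_def)
  qed (use i1 iV pt in auto)
  also have "\<dots> = expectation (\<lambda>\<omega>. \<bar>V \<omega>\<bar> ^ 3) + k\<^sup>2 * (expectation (\<lambda>\<omega>. \<bar>V \<omega>\<bar> ^ 3) + 2 * C) + k\<^sup>2 * C"
    using i1 iV E1 r_third_moment by simp
  finally show ?thesis by (simp add: algebra_simps)
qed

lemma L3_lincomb: "L3 (\<lambda>\<omega>. \<Sum>i\<in>A. k i * r (g i) \<omega>)"
  by (intro in_Lp_sum in_Lp_cmult r_in_L3) simp

lemma past_lincomb: "(\<And>i. i \<in> A \<Longrightarrow> g i \<le> s) \<Longrightarrow> past s (\<lambda>\<omega>. \<Sum>i\<in>A. k i * r (g i) \<omega>)"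
  by (intro ae_measurable_sum ae_measurable_mult ae_measurable_const r_past)

text \<open>Indices are added in increasing order, so the sum already built lies in the past of the
  new one; the factors 1 + k^2 are bounded by exponentials.\<close>

lemma third_moment_exp_bound:
  fixes k :: "int \<Rightarrow> real"
  assumes "finite J" "\<And>s. s \<in> J \<Longrightarrow> \<bar>k s\<bar> \<le> 1"
  shows "expectation (\<lambda>\<omega>. \<bar>\<Sum>s\<in>J. k s * r s \<omega>\<bar> ^ 3) + 3 * C \<le> 3 * C * exp (\<Sum>s\<in>J. (k s)\<^sup>2)"
  using assms
proof (induction J rule: finite_linorder_max_induct)
  case empty
  then show ?case by simp
next
  case (insert t J)
  let ?V = "\<lambda>\<omega>. \<Sum>s\<in>J. k s * r s \<omega>"
  have "t \<notin> J" using insert.hyps by auto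
  have "past (t - 1) ?V" by (rule past_lincomb) (use insert.hyps in force)
  then have "expectation (\<lambda>\<omega>. \<bar>?V \<omega> + k t * r t \<omega>\<bar> ^ 3) + 3 * C
      \<le> (expectation (\<lambda>\<omega>. \<bar>?V \<omega>\<bar> ^ 3) + 3 * C) * (1 + (k t)\<^sup>2)"
    by (rule third_moment_step) (use insert.prems L3_lincomb in auto)
  also have "\<dots> \<le> (3 * C * exp (\<Sum>s\<in>J. (k s)\<^sup>2)) * exp ((k t)\<^sup>2)"
    using insert C_nonneg by (intro mult_mono exp_ge_add_one_self) auto
  also have "\<dots> = 3 * C * exp (\<Sum>s\<in>insert t J. (k s)\<^sup>2)"
    using insert.hyps \<open>t \<notin> J\<close> by (simp add: exp_add)
  finally show ?case using insert.hyps \<open>t \<notin> J\<close> by (simp add: add.commute)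
qed

text \<open>A substitute for the Burkholder inequality with exponent 3: the constant follows from
  \<open>\<bar>x + y\<bar>\<^sup>3 \<le> \<bar>x\<bar>\<^sup>3 + 3 x \<bar>x\<bar> y + 3 \<bar>x\<bar> y\<^sup>2 + \<bar>y\<bar>\<^sup>3\<close>, whose second term has mean zero for a
  martingale difference \<open>y\<close>, and from rescaling to coefficients of unit norm.\<close>

lemma third_moment_bound:
  fixes k :: "int \<Rightarrow> real"
  assumes "finite J"
  shows "expectation (\<lambda>\<omega>. \<bar>\<Sum>s\<in>J. k s * r s \<omega>\<bar> ^ 3) \<le> 9 * C * sqrt (\<Sum>s\<in>J. (k s)\<^sup>2) ^ 3"
proof -
  define q where "q = sqrt (\<Sum>s\<in>J. (k s)\<^sup>2)"
  have q2: "q\<^sup>2 = (\<Sum>s\<in>J. (k s)\<^sup>2)" unfolding q_def by (simp add: sum_nonneg)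
  have q0: "0 \<le> q" unfolding q_def by (simp add: sum_nonneg)
  show ?thesis
  proof (cases "q = 0")
    case True
    then have "\<forall>s\<in>J. (k s)\<^sup>2 = 0"
      using q2 sum_nonneg_eq_0_iff[OF assms, of "\<lambda>s. (k s)\<^sup>2"] by simp
    then have "(\<Sum>s\<in>J. k s * r s \<omega>) = 0" for \<omega> by (intro sum.neutral) simp
    then show ?thesis using True unfolding q_def[symmetric] by simp
  next
    case False
    then have qp: "0 < q" using q0 by simp
    have le1: "\<bar>k s / q\<bar> \<le> 1" if "s \<in> J" for s
    proof -
      have "(k s)\<^sup>2 \<le> q\<^sup>2" unfolding q2 using that assms by (intro member_le_sum) auto
      then have "\<bar>k s\<bar> \<le> q" using q0 by (metis abs_le_square_iff abs_of_nonneg)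
      then show ?thesis using qp by simp
    qed
    have one: "(\<Sum>s\<in>J. (k s / q)\<^sup>2) = 1"
      using False by (simp add: power_divide flip: sum_divide_distrib q2)
    have "expectation (\<lambda>\<omega>. \<bar>\<Sum>s\<in>J. k s / q * r s \<omega>\<bar> ^ 3) + 3 * C \<le> 3 * C * exp 1"
      using third_moment_exp_bound[OF assms, of "\<lambda>s. k s / q"] le1 one by simp
    \<comment> \<open>The constant 9 comes from exp 1 \<le> 3; the summand 3 C on the left is then
      dropped.\<close>
    also have "\<dots> \<le> 3 * C * 3" using exp_le C_nonneg by (intro mult_left_mono) auto
    finally have *: "expectation (\<lambda>\<omega>. \<bar>\<Sum>s\<in>J. k s / q * r s \<omega>\<bar> ^ 3) \<le> 9 * C" using C_nonneg by simp
    have "(\<lambda>\<omega>. \<bar>\<Sum>s\<in>J. k s * r s \<omega>\<bar> ^ 3) = (\<lambda>\<omega>. q ^ 3 * \<bar>\<Sum>s\<in>J. k s / q * r s \<omega>\<bar> ^ 3)"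
    proof
      fix \<omega>
      have "(\<Sum>s\<in>J. k s * r s \<omega>) = q * (\<Sum>s\<in>J. k s / q * r s \<omega>)"
        using False by (simp add: sum_distrib_left)
      then show "\<bar>\<Sum>s\<in>J. k s * r s \<omega>\<bar> ^ 3 = q ^ 3 * \<bar>\<Sum>s\<in>J. k s / q * r s \<omega>\<bar> ^ 3"
        using q0 by (simp add: abs_mult power_mult_distrib)
    qed
    then have "expectation (\<lambda>\<omega>. \<bar>\<Sum>s\<in>J. k s * r s \<omega>\<bar> ^ 3) \<le> q ^ 3 * (9 * C)"
      using * qp by (simp add: mult_left_mono)
    then show ?thesis unfolding q_def[symmetric] by (simp add: mult.commute)
  qed
qed

lemma third_moment_bound_lagged:
  fixes k :: "nat \<Rightarrow> real"
  assumes "finite A"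
  shows "expectation (\<lambda>\<omega>. \<bar>\<Sum>j\<in>A. k j * r (t - int j) \<omega>\<bar> ^ 3) \<le> 9 * C * sqrt (\<Sum>j\<in>A. (k j)\<^sup>2) ^ 3"
proof -
  let ?f = "\<lambda>j. t - int j"
  have inj: "inj_on ?f A" by (auto simp: inj_on_def)
  have "expectation (\<lambda>\<omega>. \<bar>\<Sum>s\<in>?f ` A. k (nat (t - s)) * r s \<omega>\<bar> ^ 3)
      \<le> 9 * C * sqrt (\<Sum>s\<in>?f ` A. (k (nat (t - s)))\<^sup>2) ^ 3"
    by (rule third_moment_bound) (use assms in simp)
  then show ?thesis by (simp add: sum.reindex[OF inj])
qed

text \<open>The l^2 norm of the coefficients with lags greater than \<open>N\<close>, those
  occurring in \<open>X_tail t N\<close>.\<close>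

definition \<tau> :: "nat \<Rightarrow> real" where
  "\<tau> N = sqrt (\<Sum>j. (b (Suc (j + N)))\<^sup>2)"

lemma \<tau>_nonneg: "0 \<le> \<tau> N"
  unfolding \<tau>_def using summable_ignore_initial_segment[OF b_sq, of N]
  by (intro real_sqrt_ge_zero suminf_nonneg) simp_all

lemma \<tau>_tendsto_0: "\<tau> \<longlonglongrightarrow> 0"
  unfolding \<tau>_def [abs_def] using tendsto_real_sqrt[OF suminf_exist_split2[OF b_sq]] by simp

text \<open>The third-moment bound is uniform over the finite sums approximating the tail, so
  Fatou's lemma carries it to the limit.\<close>

lemma X_tail_L3: "L3 (X_tail t N)"
  and X_tail_third_moment: "expectation (\<lambda>\<omega>. \<bar>X_tail t N \<omega>\<bar> ^ 3) \<le> 9 * C * \<tau> N ^ 3"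
proof -
  obtain \<psi> where \<psi>: "\<And>n. N \<le> \<psi> n"
    and lim: "AE \<omega> in M. (\<lambda>n. \<Sum>j\<in>{N..<\<psi> n}. b (Suc j) * r (t - int (Suc j)) \<omega>) \<longlonglongrightarrow> X_tail t N \<omega>"
    by (rule X_tail_AE_limit[OF that])
  have bd: "expectation (\<lambda>\<omega>. \<bar>\<Sum>j\<in>{N..<\<psi> n}. b (Suc j) * r (t - int (Suc j)) \<omega>\<bar> ^ 3) \<le> 9 * C * \<tau> N ^ 3" for n
  proof -
    have "expectation (\<lambda>\<omega>. \<bar>\<Sum>j\<in>{N..<\<psi> n}. b (Suc j) * r (t - 1 - int j) \<omega>\<bar> ^ 3)
        \<le> 9 * C * sqrt (\<Sum>j\<in>{N..<\<psi> n}. (b (Suc j))\<^sup>2) ^ 3"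
      by (rule third_moment_bound_lagged) simp
    also have "\<dots> \<le> 9 * C * \<tau> N ^ 3"
    proof (intro mult_left_mono power_mono)
      have "(\<Sum>j\<in>{N..<\<psi> n}. (b (Suc j))\<^sup>2) = (\<Sum>j<\<psi> n - N. (b (Suc (j + N)))\<^sup>2)"
        by (rule sum.reindex_bij_witness[of _ "\<lambda>j. j + N" "\<lambda>j. j - N"]) auto
      also have "\<dots> \<le> (\<Sum>j. (b (Suc (j + N)))\<^sup>2)"
        using summable_ignore_initial_segment[OF b_sq, of N] by (intro sum_le_suminf) simp_all
      finally show "sqrt (\<Sum>j\<in>{N..<\<psi> n}. (b (Suc j))\<^sup>2) \<le> \<tau> N"
        unfolding \<tau>_def by (rule real_sqrt_le_mono)
    qed (use C_nonneg in \<open>auto simp: sum_nonneg\<close>)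
    finally show ?thesis by (simp add: diff_diff_eq)
  qed
  have K: "0 \<le> 9 * C * \<tau> N ^ 3" using C_nonneg \<tau>_nonneg by simp
  show "L3 (X_tail t N)" by (rule AE_limit_Lp_bound(1)[OF L3_lincomb X_tail_measurable lim bd K])
  show "expectation (\<lambda>\<omega>. \<bar>X_tail t N \<omega>\<bar> ^ 3) \<le> 9 * C * \<tau> N ^ 3"
    by (rule AE_limit_Lp_bound(2)[OF L3_lincomb X_tail_measurable lim bd K])
qed

text \<open>Hoelder's inequality with exponents 3/2 and 3, up to the constant, by Young's inequality
  with a scale \<delta>. At \<delta> \<ge> q the two terms contribute 2/3 and 9/3, whence 11/3. As
  \<open>q\<close> may be 0, a positive \<delta> is used and then lowered to
  \<open>q\<close>.\<close>

lemma integral_r_sq_mult_le: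
  assumes D: "L3 D" and q: "0 \<le> q" and bd: "expectation (\<lambda>\<omega>. \<bar>D \<omega>\<bar> ^ 3) \<le> 9 * C * q ^ 3"
  shows "\<bar>expectation (\<lambda>\<omega>. (r 0 \<omega>)\<^sup>2 * D \<omega>)\<bar> \<le> 11 / 3 * C * q"
proof -
  have main: "\<bar>expectation (\<lambda>\<omega>. (r 0 \<omega>)\<^sup>2 * D \<omega>)\<bar> \<le> 11 / 3 * C * \<delta>" if \<delta>: "0 < \<delta>" "q \<le> \<delta>" for \<delta>
  proof -
    have pt: "\<bar>x\<^sup>2 * y\<bar> \<le> \<delta> * (2 / 3) * \<bar>x\<bar> ^ 3 + 1 / (3 * \<delta>\<^sup>2) * \<bar>y\<bar> ^ 3" for x y :: real
    proof -
      have "3 * (\<bar>y\<bar> / \<delta>) * \<bar>x\<bar>\<^sup>2 \<le> (\<bar>y\<bar> / \<delta>) ^ 3 + 2 * \<bar>x\<bar> ^ 3" using \<delta> by (intro Young_cubic) auto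
      then have "\<delta> / 3 * (3 * (\<bar>y\<bar> / \<delta>) * \<bar>x\<bar>\<^sup>2) \<le> \<delta> / 3 * ((\<bar>y\<bar> / \<delta>) ^ 3 + 2 * \<bar>x\<bar> ^ 3)"
        using \<delta> by (intro mult_left_mono) auto
      also have "\<delta> / 3 * (3 * (\<bar>y\<bar> / \<delta>) * \<bar>x\<bar>\<^sup>2) = \<bar>x\<^sup>2 * y\<bar>" using \<delta> by (simp add: abs_mult)
      also have "\<delta> / 3 * ((\<bar>y\<bar> / \<delta>) ^ 3 + 2 * \<bar>x\<bar> ^ 3) = \<delta> * (2 / 3) * \<bar>x\<bar> ^ 3 + 1 / (3 * \<delta>\<^sup>2) * \<bar>y\<bar> ^ 3"
        using \<delta> by (simp add: power2_eq_square power3_eq_cube field_simps)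
      finally show ?thesis .
    qed
    have i: "integrable M (\<lambda>\<omega>. \<bar>D \<omega>\<bar> ^ 3)" "integrable M (\<lambda>\<omega>. \<bar>r 0 \<omega>\<bar> ^ 3)"
      using D r_in_L3[of 0] by (simp_all add: in_Lp_def)
    have "\<bar>expectation (\<lambda>\<omega>. (r 0 \<omega>)\<^sup>2 * D \<omega>)\<bar> \<le> expectation (\<lambda>\<omega>. \<bar>(r 0 \<omega>)\<^sup>2 * D \<omega>\<bar>)"
      by (rule integral_abs_bound)
    also have "\<dots> \<le> expectation (\<lambda>\<omega>. \<delta> * (2 / 3) * \<bar>r 0 \<omega>\<bar> ^ 3 + 1 / (3 * \<delta>\<^sup>2) * \<bar>D \<omega>\<bar> ^ 3)"
      using i L3_integrable_sq_mult[OF r_in_L3 D] pt by (intro integral_mono) auto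
    also have "\<dots> = \<delta> * (2 / 3) * C + 1 / (3 * \<delta>\<^sup>2) * expectation (\<lambda>\<omega>. \<bar>D \<omega>\<bar> ^ 3)"
      using i by (simp add: C_def)
    also have "\<dots> \<le> \<delta> * (2 / 3) * C + 1 / (3 * \<delta>\<^sup>2) * (9 * C * \<delta> ^ 3)"
    proof (intro add_left_mono mult_left_mono order_trans[OF bd])
      show "q ^ 3 \<le> \<delta> ^ 3" using \<delta> q by (intro power_mono)
    qed (use C_nonneg in auto)
    also have "\<dots> = 11 / 3 * C * \<delta>" using \<delta> by (simp add: power2_eq_square power3_eq_cube field_simps)
    finally show ?thesis .
  qed
  show ?thesis
  proof (rule field_le_epsilon)
    fix e :: real assume e: "0 < e"
    \<comment> \<open>The added 1 keeps the denominator positive when C = 0.\<close>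
    let ?d = "e / (11 / 3 * C + 1)"
    have p: "0 < 11 / 3 * C + 1" using C_nonneg by simp
    have "\<bar>expectation (\<lambda>\<omega>. (r 0 \<omega>)\<^sup>2 * D \<omega>)\<bar> \<le> 11 / 3 * C * (q + ?d)"
      using e p q by (intro main add_nonneg_pos divide_pos_pos) (auto simp: C_nonneg)
    also have "\<dots> = 11 / 3 * C * q + 11 / 3 * C * ?d" by (simp only: distrib_left)
    also have "11 / 3 * C * ?d \<le> (11 / 3 * C + 1) * ?d" using e p by (intro mult_right_mono) auto
    also have "(11 / 3 * C + 1) * ?d = e" using p by simp
    finally show "\<bar>expectation (\<lambda>\<omega>. (r 0 \<omega>)\<^sup>2 * D \<omega>)\<bar> \<le> 11 / 3 * C * q + e" by simp
  qed
qed

section \<open>The leverage function as values of the functional D \<mapsto> E[r_0^2 D]\<close>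

abbreviation h :: "nat \<Rightarrow> real" where "h \<equiv> leverage M r"

lemma h_eq_lagged: "h n = expectation (\<lambda>\<omega>. (r 0 \<omega>)\<^sup>2 * r (- int n) \<omega>)"
  using strictly_stationary_distr2(2)[OF r_stat, of "\<lambda>x y. x\<^sup>2 * y" 0 "int n" "- int n"]
  by (simp add: leverage_def)

lemma h_0: "h 0 = 0"
  using r_cubed_\<sigma>2(1)[of 0] by (simp add: leverage_def power3_eq_cube power2_eq_square mult.assoc)

text \<open>Duality: \<open>h j\<close> is the value of this functional at \<open>r (- j)\<close>.
  On the combination \<open>?Z\<close> with coefficients \<open>h j\<close> it equals q^2, while its
  norm bound gives at most 11/3 C q. Hence q \<le> 11/3 C uniformly in \<open>N\<close>.\<close>

lemma h_square_summable: "summable (\<lambda>n. (h n)\<^sup>2)"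
proof (rule summableI_nonneg_bounded)
  fix N
  let ?Z = "\<lambda>\<omega>. \<Sum>j<N. h j * r (0 - int j) \<omega>"
  define q where "q = sqrt (\<Sum>n<N. (h n)\<^sup>2)"
  have q0: "0 \<le> q" unfolding q_def by (simp add: sum_nonneg)
  have q2: "q\<^sup>2 = (\<Sum>n<N. (h n)\<^sup>2)" unfolding q_def by (simp add: sum_nonneg)
  have "expectation (\<lambda>\<omega>. (r 0 \<omega>)\<^sup>2 * ?Z \<omega>) = expectation (\<lambda>\<omega>. \<Sum>j<N. h j * ((r 0 \<omega>)\<^sup>2 * r (0 - int j) \<omega>))"
    by (simp add: sum_distrib_left mult.left_commute)
  also have "\<dots> = (\<Sum>j<N. h j * h j)"
    using L3_integrable_sq_mult[OF r_in_L3 r_in_L3] by (simp add: h_eq_lagged)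
  also have "\<dots> = q\<^sup>2" unfolding q2 by (simp add: power2_eq_square)
  finally have "expectation (\<lambda>\<omega>. (r 0 \<omega>)\<^sup>2 * ?Z \<omega>) = q\<^sup>2" .
  moreover have "\<bar>expectation (\<lambda>\<omega>. (r 0 \<omega>)\<^sup>2 * ?Z \<omega>)\<bar> \<le> 11 / 3 * C * q"
    by (rule integral_r_sq_mult_le[OF L3_lincomb q0]) (unfold q_def, rule third_moment_bound_lagged, simp)
  ultimately have "q * q \<le> 11 / 3 * C * q" by (simp add: power2_eq_square)
  then have "q \<le> 11 / 3 * C" using q0 C_nonneg by (cases "q = 0") auto
  then have "q\<^sup>2 \<le> (11 / 3 * C)\<^sup>2" using q0 by (intro power_mono)
  then show "(\<Sum>n<N. (h n)\<^sup>2) \<le> (11 / 3 * C)\<^sup>2" by (simp only: q2)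
qed simp

text \<open>The tail with \<open>N = t\<close> at time \<open>t\<close> consists of the terms in
  r_{-1}, r_{-2}, and so on. The functional is evaluated term by term; the remainder after
  \<open>N\<close> terms is bounded by a multiple of \<open>\<tau> (N + t)\<close>, which tends to
  0.\<close>

lemma integral_r_sq_mult_X_tail:
  "expectation (\<lambda>\<omega>. (r 0 \<omega>)\<^sup>2 * X_tail (int t) t \<omega>) = (\<Sum>i. b (Suc (t + i)) * h (Suc i))"
proof (rule sums_unique)
  let ?E = "expectation (\<lambda>\<omega>. (r 0 \<omega>)\<^sup>2 * X_tail (int t) t \<omega>)"
  have eq: "?E - (\<Sum>i<N. b (Suc (t + i)) * h (Suc i)) = expectation (\<lambda>\<omega>. (r 0 \<omega>)\<^sup>2 * X_tail (int t) (N + t) \<omega>)" for N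
  proof -
    have split: "X_tail (int t) t \<omega> = (\<Sum>i<N. b (Suc (t + i)) * r (- int (Suc i)) \<omega>) + X_tail (int t) (N + t) \<omega>" for \<omega>
    proof -
      let ?g = "\<lambda>j. b (Suc j) * r (int t - int (Suc j)) \<omega>"
      have "(\<Sum>j<N + t. ?g j) = (\<Sum>j<t. ?g j) + (\<Sum>j\<in>{t..<N + t}. ?g j)"
        using sum.atLeastLessThan_concat[of 0 t "N + t" ?g] by (simp add: atLeast0LessThan)
      also have "(\<Sum>j\<in>{t..<N + t}. ?g j) = (\<Sum>i<N. b (Suc (t + i)) * r (- int (Suc i)) \<omega>)"
        by (rule sum.reindex_bij_witness[of _ "\<lambda>i. t + i" "\<lambda>j. j - t"])
            (auto simp: algebra_simps)
      finally show ?thesis by (simp add: X_tail_def)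
    qed
    have "?E = expectation (\<lambda>\<omega>. (\<Sum>i<N. b (Suc (t + i)) * ((r 0 \<omega>)\<^sup>2 * r (- int (Suc i)) \<omega>))
        + (r 0 \<omega>)\<^sup>2 * X_tail (int t) (N + t) \<omega>)"
      unfolding split by (simp add: distrib_left sum_distrib_left mult.left_commute)
    also have "\<dots> = (\<Sum>i<N. b (Suc (t + i)) * h (Suc i)) + expectation (\<lambda>\<omega>. (r 0 \<omega>)\<^sup>2 * X_tail (int t) (N + t) \<omega>)"
      unfolding h_eq_lagged
      using L3_integrable_sq_mult[OF r_in_L3 r_in_L3] L3_integrable_sq_mult[OF r_in_L3 X_tail_L3]
      by (subst Bochner_Integration.integral_add) (auto intro!: Bochner_Integration.integrable_sum)
    finally show ?thesis by simp
  qed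
  have "(\<lambda>N. ?E - (\<Sum>i<N. b (Suc (t + i)) * h (Suc i))) \<longlonglongrightarrow> 0"
  proof (rule Lim_null_comparison)
    show "\<forall>\<^sub>F N in sequentially. norm (?E - (\<Sum>i<N. b (Suc (t + i)) * h (Suc i))) \<le> 11 / 3 * C * \<tau> (N + t)"
      unfolding eq using integral_r_sq_mult_le[OF X_tail_L3 \<tau>_nonneg X_tail_third_moment] by simp
    show "(\<lambda>N. 11 / 3 * C * \<tau> (N + t)) \<longlonglongrightarrow> 0"
      by (intro tendsto_mult_right_zero LIMSEQ_ignore_initial_segment \<tau>_tendsto_0)
  qed
  from tendsto_diff[OF tendsto_const[of ?E] this]
  show "(\<lambda>i. b (Suc (t + i)) * h (Suc i)) sums ?E" by (simp add: sums_def)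
qed

section \<open>The recursion for the leverage function\<close>

lemma h_future: "integrable M (\<lambda>\<omega>. \<sigma>2 (int n) \<omega> * r 0 \<omega>)"
  "expectation (\<lambda>\<omega>. \<sigma>2 (int n) \<omega> * r 0 \<omega>) = h n"
proof -
  have "integrable M (\<lambda>\<omega>. \<sigma>2 (int n) \<omega> * r 0 \<omega>) \<and> expectation (\<lambda>\<omega>. \<sigma>2 (int n) \<omega> * r 0 \<omega>) = h n"
  proof (cases "n = 0")
    case True
    then show ?thesis using r_cubed_\<sigma>2(2,3)[of 0] h_0 by simp
  next
    case False
    have "past 0 (r 0)" by (rule r_past) simp
    from integral_r_sq_mult_past[OF this _ L3_integrable_sq_mult[OF r_in_L3 r_in_L3], of "int n"] False
    show ?thesis by (simp add: leverage_def)
  qed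
  then show "integrable M (\<lambda>\<omega>. \<sigma>2 (int n) \<omega> * r 0 \<omega>)"
    "expectation (\<lambda>\<omega>. \<sigma>2 (int n) \<omega> * r 0 \<omega>) = h n" by auto
qed

lemma integral_future_lincomb_mult_past:
  fixes k :: "nat \<Rightarrow> real"
  assumes A: "0 \<notin> A" and V: "past 0 V" and i: "\<And>u. integrable M (\<lambda>\<omega>. r u \<omega> * V \<omega>)"
  shows "expectation (\<lambda>\<omega>. (\<Sum>u\<in>A. k u * r (int u) \<omega>) * V \<omega>) = 0"
proof -
  have "expectation (\<lambda>\<omega>. (\<Sum>u\<in>A. k u * r (int u) \<omega>) * V \<omega>) = expectation (\<lambda>\<omega>. \<Sum>u\<in>A. k u * (r (int u) \<omega> * V \<omega>))"
    by (simp add: sum_distrib_right mult.assoc)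
  also have "\<dots> = (\<Sum>u\<in>A. k u * expectation (\<lambda>\<omega>. r (int u) \<omega> * V \<omega>))"
    using i by simp
  also have "\<dots> = 0"
  proof (rule sum.neutral, rule ballI)
    fix u assume "u \<in> A"
    then have "0 < int u" using A by (cases "u = 0") auto
    then show "k u * expectation (\<lambda>\<omega>. r (int u) \<omega> * V \<omega>) = 0"
      using integral_r_mult_past[OF V _ i] by simp
  qed
  finally show ?thesis .
qed

text \<open>Off-diagonal products vanish: in each of them the factor with the latest time is a
  martingale difference against the others. Adding the largest index last exposes that
  factor.\<close>

lemma integral_r_mult_future_square:
  fixes k :: "nat \<Rightarrow> real"
  assumes "finite A" "0 \<notin> A"
  shows "expectation (\<lambda>\<omega>. (\<Sum>u\<in>A. k u * r (int u) \<omega>)\<^sup>2 * r 0 \<omega>) = (\<Sum>u\<in>A. (k u)\<^sup>2 * h u)"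
  using assms
proof (induction A rule: finite_linorder_max_induct)
  case empty
  then show ?case by simp
next
  case (insert t A)
  let ?V = "\<lambda>\<omega>. \<Sum>u\<in>A. k u * r (int u) \<omega>"
  have tA: "t \<notin> A" using insert.hyps by auto
  have V: "L3 ?V" by (rule L3_lincomb)
  have pV: "past (int t - 1) (\<lambda>\<omega>. ?V \<omega> * r 0 \<omega>)"
    by (intro ae_measurable_mult past_lincomb r_past) (use insert in \<open>force+\<close>)
  have i1: "integrable M (\<lambda>\<omega>. (?V \<omega>)\<^sup>2 * r 0 \<omega>)" by (rule L3_integrable_sq_mult[OF V r_in_L3])
  have i2: "integrable M (\<lambda>\<omega>. r (int t) \<omega> * (?V \<omega> * r 0 \<omega>))"
    using integrable_mult3_L3[OF r_in_L3 V r_in_L3] by (simp only: mult.assoc)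
  have i3: "integrable M (\<lambda>\<omega>. (r (int t) \<omega>)\<^sup>2 * r 0 \<omega>)" by (rule L3_integrable_sq_mult[OF r_in_L3 r_in_L3])
  have "expectation (\<lambda>\<omega>. (\<Sum>u\<in>insert t A. k u * r (int u) \<omega>)\<^sup>2 * r 0 \<omega>)
    = expectation (\<lambda>\<omega>. (?V \<omega>)\<^sup>2 * r 0 \<omega> + 2 * k t * (r (int t) \<omega> * (?V \<omega> * r 0 \<omega>))
        + (k t)\<^sup>2 * ((r (int t) \<omega>)\<^sup>2 * r 0 \<omega>))"
    unfolding sum.insert[OF insert.hyps(1) tA]
    by (intro Bochner_Integration.integral_cong refl) (simp only: power2_eq_square algebra_simps)
  also have "\<dots> = expectation (\<lambda>\<omega>. (?V \<omega>)\<^sup>2 * r 0 \<omega>)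
      + 2 * k t * expectation (\<lambda>\<omega>. r (int t) \<omega> * (?V \<omega> * r 0 \<omega>)) + (k t)\<^sup>2 * h t"
    using i1 i2 i3 by (simp add: leverage_def)
  also have "expectation (\<lambda>\<omega>. r (int t) \<omega> * (?V \<omega> * r 0 \<omega>)) = 0"
    by (rule integral_r_mult_past[OF pV _ i2]) simp
  finally show ?case using insert tA by (simp add: add.commute)
qed

definition m :: real where "m = expectation (\<lambda>\<omega>. (r 0 \<omega>)\<^sup>2)"

lemma r_integrable_sq: "integrable M (\<lambda>\<omega>. (r t \<omega>)\<^sup>2)"
  using L3_integrable2[OF r_in_L3 r_in_L3] by (simp add: power2_eq_square)

lemma r_second_moment: "expectation (\<lambda>\<omega>. (r t \<omega>)\<^sup>2) = m"
  using strictly_stationary_distr2(2)[OF r_stat, of "\<lambda>x y. x\<^sup>2" 0 t 0] by (simp add: m_def)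

text \<open>If m = 0, then all \<open>r t\<close> and hence \<open>X 0\<close> vanish almost
  everywhere, so \<open>\<sigma>2 0\<close> is at least a^2; but its mean is
  \<open>m\<close>.\<close>

lemma m_pos: "0 < m"
proof (rule ccontr)
  assume "\<not> 0 < m"
  moreover have "0 \<le> m" unfolding m_def by simp
  ultimately have m0: "m = 0" by simp
  have r0: "AE \<omega> in M. r t \<omega> = 0" for t
    using r_second_moment[of t] integral_nonneg_eq_0_iff_AE[OF r_integrable_sq[of t]] m0 by simp
  obtain \<psi> where lim: "AE \<omega> in M. (\<lambda>n. \<Sum>j\<in>{0..<\<psi> n}. b (Suc j) * r (0 - int (Suc j)) \<omega>) \<longlonglongrightarrow> X_tail 0 0 \<omega>"
    by (rule X_tail_AE_limit)
  have "AE \<omega> in M. \<forall>j. r (0 - int (Suc j)) \<omega> = 0"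
    unfolding AE_all_countable using r0 by blast
  with lim have X0: "AE \<omega> in M. X 0 \<omega> = 0"
    by eventually_elim (auto simp: X_tail_def LIMSEQ_const_iff)
  have i: "integrable M (\<lambda>\<omega>. (r 0 \<omega>)\<^sup>2 * 1)" using r_integrable_sq by simp
  have "expectation (\<lambda>\<omega>. a\<^sup>2) \<le> expectation (\<lambda>\<omega>. \<sigma>2 0 \<omega> * 1)"
  proof (rule integral_mono_AE)
    show "integrable M (\<lambda>\<omega>. \<sigma>2 0 \<omega> * 1)"
      by (rule integral_r_sq_mult_past(1)[OF ae_measurable_const[of M "generated_by_past M \<zeta> (- 1)" 1] _ i]) auto
    show "AE \<omega> in M. a\<^sup>2 \<le> \<sigma>2 0 \<omega> * 1"
      using \<sigma>2_lower[of 0] X0 by eventually_elim simp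
  qed simp
  also have "\<dots> = expectation (\<lambda>\<omega>. (r 0 \<omega>)\<^sup>2 * 1)"
    by (rule integral_r_sq_mult_past(2)[OF ae_measurable_const[of M "generated_by_past M \<zeta> (- 1)" 1] _ i, symmetric]) auto
  also have "\<dots> = 0" using m0 by (simp add: m_def)
  finally have "a\<^sup>2 \<le> 0" by (simp add: prob_space)
  then show False using a by simp
qed

lemma r_mean: "expectation (r t) = 0"
  using integral_r_mult_past[OF ae_measurable_const[of M _ 1], of "t - 1" t] L3_integrable1[OF r_in_L3]
  by simp

text \<open>The index is shifted by one: \<open>w n\<close> belongs to time n + 1 and is E[r_0^2 Y],
  with Y the part of X_{n+1} from times before 0.\<close>

definition w :: "nat \<Rightarrow> real" where
  "w n = (\<Sum>i. b (Suc (Suc n + i)) * h (Suc i))"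

text \<open>X_{n+1} is split into a future part \<open>?P\<close> (times 1 to n), the term in
  \<open>r 0\<close>, and a past part \<open>?Y\<close>. After multiplying the recursion for
  \<open>\<sigma>2\<close> by \<open>r 0\<close>, every product whose latest factor occurs to the
  first power has mean 0, and so does the cube of \<open>r 0\<close>. The survivors are \<gamma>
  h_n, the square of \<open>?P\<close>, and the terms of a X and of r_0 \<open>?Y\<close> that carry
  the square of \<open>r 0\<close>.\<close>

lemma h_recursion:
  "h (Suc n) = \<gamma> * h n + (\<Sum>u\<le>n. (b (Suc (n - u)))\<^sup>2 * h u) + 2 * b (Suc n) * (a * m + w n)"
proof -
  let ?t = "int (Suc n)" and ?\<beta> = "b (Suc n)"
  let ?k = "\<lambda>u. b (Suc (n - u))"
  let ?P = "\<lambda>\<omega>. \<Sum>u\<in>{1..n}. ?k u * r (int u) \<omega>"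
  let ?Y = "X_tail ?t (Suc n)"
  have X_eq: "X ?t \<omega> = ?P \<omega> + ?\<beta> * r 0 \<omega> + ?Y \<omega>" for \<omega>
  proof -
    have "(\<Sum>j<n. b (Suc j) * r (?t - int (Suc j)) \<omega>) = ?P \<omega>"
      by (rule sum.reindex_bij_witness[of _ "\<lambda>u. n - u" "\<lambda>j. n - j"]) (auto simp: algebra_simps)
    then show ?thesis by (simp add: X_tail_def)
  qed
  have P: "L3 ?P" by (rule L3_lincomb)
  have Y: "L3 ?Y" by (rule X_tail_L3)
  have Y_past: "past (- 1) ?Y" by (rule X_tail_past) simp
  have Y_past0: "past 0 ?Y" by (rule X_tail_past) simp
  have r0_past: "past 0 (r 0)" by (rule r_past) simp
  note r0 = r_in_L3[of 0]
  have iP: "integrable M (\<lambda>\<omega>. ?P \<omega> * r 0 \<omega>)" by (rule L3_integrable2[OF P r0])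
  have iY: "integrable M (\<lambda>\<omega>. r 0 \<omega> * ?Y \<omega>)" by (rule L3_integrable2[OF r0 Y])
  have i1: "integrable M (\<lambda>\<omega>. (?P \<omega>)\<^sup>2 * r 0 \<omega>)" by (rule L3_integrable_sq_mult[OF P r0])
  have i2: "integrable M (\<lambda>\<omega>. r 0 \<omega> ^ 3)" using integrable_mult3_L3[OF r0 r0 r0] by (simp add: power3_eq_cube)
  have i3: "integrable M (\<lambda>\<omega>. r 0 \<omega> * (?Y \<omega>)\<^sup>2)" using L3_integrable_sq_mult[OF Y r0] by (simp only: mult.commute)
  have i4: "integrable M (\<lambda>\<omega>. ?P \<omega> * (r 0 \<omega>)\<^sup>2)" using L3_integrable_sq_mult[OF r0 P] by (simp only: mult.commute)
  have i5: "integrable M (\<lambda>\<omega>. ?P \<omega> * (r 0 \<omega> * ?Y \<omega>))"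
    using integrable_mult3_L3[OF P r0 Y] by (simp only: mult.assoc)
  have i6: "integrable M (\<lambda>\<omega>. (r 0 \<omega>)\<^sup>2 * ?Y \<omega>)" by (rule L3_integrable_sq_mult[OF r0 Y])
  have iP': "integrable M (\<lambda>\<omega>. r u \<omega> * r 0 \<omega>)" for u by (rule L3_integrable2[OF r_in_L3 r0])
  have e1: "expectation (\<lambda>\<omega>. (?P \<omega>)\<^sup>2 * r 0 \<omega>) = (\<Sum>u\<le>n. (?k u)\<^sup>2 * h u)"
  proof -
    have "expectation (\<lambda>\<omega>. (?P \<omega>)\<^sup>2 * r 0 \<omega>) = (\<Sum>u\<in>{1..n}. (?k u)\<^sup>2 * h u)"
      by (rule integral_r_mult_future_square) auto
    \<comment> \<open>The index u = 0 may be added since \<open>h 0 = 0\<close>; this gives the full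
      convolution form.\<close>
    also have "\<dots> = (\<Sum>u\<le>n. (?k u)\<^sup>2 * h u)"
      by (rule sum.mono_neutral_left) (auto simp: h_0 not_less_eq_eq)
    finally show ?thesis .
  qed
  have e2: "expectation (\<lambda>\<omega>. r 0 \<omega> ^ 3) = 0" by (rule r_cubed_\<sigma>2)
  have e3: "expectation (\<lambda>\<omega>. r 0 \<omega> * (?Y \<omega>)\<^sup>2) = 0"
    by (rule integral_r_mult_past[OF ae_measurable_compose[OF Y_past, of "\<lambda>x. x\<^sup>2"] _ i3]) auto
  have e4: "expectation (\<lambda>\<omega>. ?P \<omega> * (r 0 \<omega>)\<^sup>2) = 0"
    by (rule integral_future_lincomb_mult_past[OF _ ae_measurable_compose[OF r0_past, of "\<lambda>x. x\<^sup>2"]])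
       (use L3_integrable_sq_mult[OF r0 r_in_L3] in \<open>auto simp: mult.commute\<close>)
  have e5: "expectation (\<lambda>\<omega>. ?P \<omega> * (r 0 \<omega> * ?Y \<omega>)) = 0"
    by (rule integral_future_lincomb_mult_past[OF _ ae_measurable_mult[OF r0_past Y_past0]])
       (use integrable_mult3_L3[OF r_in_L3 r0 Y] in \<open>auto simp: mult.assoc\<close>)
  have e6: "expectation (\<lambda>\<omega>. (r 0 \<omega>)\<^sup>2 * ?Y \<omega>) = w n"
    unfolding w_def by (rule integral_r_sq_mult_X_tail)
  have eP: "expectation (\<lambda>\<omega>. ?P \<omega> * r 0 \<omega>) = 0"
    by (rule integral_future_lincomb_mult_past[OF _ r0_past iP']) auto
  have eY: "expectation (\<lambda>\<omega>. r 0 \<omega> * ?Y \<omega>) = 0"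
    by (rule integral_r_mult_past[OF Y_past _ iY]) auto
  have eq: "AE \<omega> in M. \<sigma>2 ?t \<omega> * r 0 \<omega> =
      \<gamma> * (\<sigma>2 (int n) \<omega> * r 0 \<omega>) + (c\<^sup>2 + a\<^sup>2) * r 0 \<omega>
      + 2 * a * (?P \<omega> * r 0 \<omega>) + 2 * a * ?\<beta> * (r 0 \<omega>)\<^sup>2 + 2 * a * (r 0 \<omega> * ?Y \<omega>)
      + (?P \<omega>)\<^sup>2 * r 0 \<omega> + ?\<beta>\<^sup>2 * r 0 \<omega> ^ 3 + r 0 \<omega> * (?Y \<omega>)\<^sup>2
      + 2 * ?\<beta> * (?P \<omega> * (r 0 \<omega>)\<^sup>2) + 2 * (?P \<omega> * (r 0 \<omega> * ?Y \<omega>)) + 2 * ?\<beta> * ((r 0 \<omega>)\<^sup>2 * ?Y \<omega>)"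
    using \<sigma>2_recursion[of ?t]
  proof eventually_elim
    case (elim \<omega>)
    have tn: "?t - 1 = int n" by simp
    define p where "p = ?P \<omega>"
    show ?case unfolding elim tn X_eq p_def[symmetric]
      by (simp only: power2_eq_square power3_eq_cube algebra_simps)
  qed
  have [measurable]: "?P \<in> borel_measurable M" by measurable
  have "h (Suc n) = expectation (\<lambda>\<omega>. \<sigma>2 ?t \<omega> * r 0 \<omega>)" by (rule h_future(2)[symmetric])
  also have "\<dots> = expectation (\<lambda>\<omega>.
      \<gamma> * (\<sigma>2 (int n) \<omega> * r 0 \<omega>) + (c\<^sup>2 + a\<^sup>2) * r 0 \<omega>
      + 2 * a * (?P \<omega> * r 0 \<omega>) + 2 * a * ?\<beta> * (r 0 \<omega>)\<^sup>2 + 2 * a * (r 0 \<omega> * ?Y \<omega>)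
      + (?P \<omega>)\<^sup>2 * r 0 \<omega> + ?\<beta>\<^sup>2 * r 0 \<omega> ^ 3 + r 0 \<omega> * (?Y \<omega>)\<^sup>2
      + 2 * ?\<beta> * (?P \<omega> * (r 0 \<omega>)\<^sup>2) + 2 * (?P \<omega> * (r 0 \<omega> * ?Y \<omega>)) + 2 * ?\<beta> * ((r 0 \<omega>)\<^sup>2 * ?Y \<omega>))"
    by (rule integral_cong_AE[OF _ _ eq]) measurable
  also have "\<dots> = \<gamma> * h n + 2 * a * ?\<beta> * m + (\<Sum>u\<le>n. (?k u)\<^sup>2 * h u) + 2 * ?\<beta> * w n"
    using h_future[of n] L3_integrable1[OF r0] r_integrable_sq[of 0] iP iY i1 i2 i3 i4 i5 i6
    by (simp add: e1 e2 e3 e4 e5 e6 eP eY r_mean m_def del: One_nat_def of_nat_Suc)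
  finally show ?thesis by (simp add: algebra_simps)
qed

text \<open>The two sequence lemmas are applied with d = a m and \<beta>_j = b_{j+1}. Positivity of
  \<open>m\<close> makes d nonzero and gives it the sign of \<open>a\<close>.\<close>

lemma leverage_sign:
  assumes "1 / (1 - \<gamma>) * (\<Sum>j. (b (Suc j))\<^sup>2) < 1 / 5"
    and first: "0 < e * (a * b 1)" and rest: "\<And>j. 2 \<le> j \<Longrightarrow> j \<le> n \<Longrightarrow> 0 \<le> e * (a * b j)"
    and n: "1 \<le> n"
  shows "0 < e * h n"
proof -
  obtain i where i: "n = Suc i" using n by (cases n) auto
  have "a * m \<noteq> 0" using a m_pos by simp
  note w_small = leverage_recursion_perturbation_small[where h = h and w = w and \<beta> = "\<lambda>j. b (Suc j)",
      OF \<gamma> b_sq assms(1) h_square_summable h_0 h_recursion w_def this]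
  have scale: "e * (a * m * y) = m * (e * (a * y))" for y by simp
  have sgn: "0 \<le> e * (a * b (Suc j))" if "j \<le> i" for j
    using first rest[of "Suc j"] that i by (cases "j = 0") auto
  show ?thesis unfolding i
  proof (rule leverage_recursion_sign[where h = h and w = w and \<beta> = "\<lambda>j. b (Suc j)",
      OF \<gamma>(1) h_0 h_recursion w_small])
    show "0 < e * (a * m * b (Suc 0))" unfolding scale using first m_pos by simp
    show "0 \<le> e * (a * m * b (Suc j))" if "j \<le> i" for j
      unfolding scale using sgn[OF that] m_pos by simp
  qed
qed

end

section \<open>Assembling the negative and the positive case\<close>

theorem proposition9:
  fixes M :: "'a measure"
    and \<zeta> r :: "int \<Rightarrow> 'a \<Rightarrow> real"
    and \<gamma> a c :: real
    and b :: "nat \<Rightarrow> real"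
    and k :: enat
  assumes "prob_space M"
    and "0 \<le> \<gamma>" and "\<gamma> < 1" and "a \<noteq> 0"
    and "prob_space.indep_vars M (\<lambda>_. borel) \<zeta> UNIV"
    and "\<And>t. distr M borel (\<zeta> t) = distr M borel (\<zeta> 0)"
    and "integrable M (\<lambda>\<omega>. (\<zeta> 0 \<omega>)\<^sup>2)"
    and "prob_space.expectation M (\<zeta> 0) = 0"
    and "prob_space.variance M (\<zeta> 0) = 1"
    and "L2_solution M \<zeta> \<gamma> a c b r"
    and "strictly_stationary M r"
    and "integrable M (\<lambda>\<omega>. \<bar>r 0 \<omega>\<bar> ^ 3)"
    and "integrable M (\<lambda>\<omega>. \<bar>\<zeta> 0 \<omega>\<bar> ^ 3)"
    and "summable (\<lambda>j. (b (Suc j))\<^sup>2)"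
    and "1 / (1 - \<gamma>) * (\<Sum>j. (b (Suc j))\<^sup>2) < 1 / 5"
    and "prob_space.expectation M (\<lambda>\<omega>. \<zeta> 0 \<omega> ^ 3) = 0"
    and "1 \<le> k"
  shows "(a * b 1 < 0 \<and> (\<forall>j\<ge>2. enat j \<le> k \<longrightarrow> a * b j \<le> 0) \<longrightarrow>
            has_leverage_of_order M r k) \<and>
         (a * b 1 > 0 \<and> (\<forall>j\<ge>2. enat j \<le> k \<longrightarrow> a * b j \<ge> 0) \<longrightarrow>
            (\<forall>j\<ge>1. enat j \<le> k \<longrightarrow> leverage M r j > 0))"
proof -
  obtain X \<sigma>2 where
    sol: "adapted_to (generated_by_past M \<zeta>) r"
      "\<And>t. sums_in_Lp 2 M (\<lambda>j \<omega>. b (Suc j) * r (t - int (Suc j)) \<omega>) (X t)"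
      "\<And>t. sums_in_Lp 1 M (\<lambda>l \<omega>. \<gamma> ^ l * (c\<^sup>2 + (a + X (t - int l) \<omega>)\<^sup>2)) (\<sigma>2 t)"
      "\<And>t. AE \<omega> in M. r t \<omega> = \<zeta> t \<omega> * sqrt (\<sigma>2 t \<omega>)"
    using assms(10) unfolding L2_solution_def by blast
  have "leverage_model M \<zeta> r X \<sigma>2 \<gamma> a c b"
    unfolding leverage_model_def leverage_model_axioms_def
    using assms(1-9,11-14,16) sol by blast
  then interpret leverage_model M \<zeta> r X \<sigma>2 \<gamma> a c b .
  have neg: "leverage M r j < 0"
    if "a * b 1 < 0" "\<forall>j\<ge>2. enat j \<le> k \<longrightarrow> a * b j \<le> 0" "1 \<le> j" "enat j \<le> k" for j
  proof -
    \<comment> \<open>The choice e = -1 reverses all signs and yields case (i); e = 1 below yields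
      case (ii). Only indices up to \<open>j\<close> are involved, so the coefficient condition up
      to \<open>k\<close> suffices even for infinite \<open>k\<close>.\<close>
    have "0 < - 1 * leverage M r j"
    proof (rule leverage_sign[OF assms(15)])
      fix i assume "2 \<le> i" "i \<le> j"
      moreover have "enat i \<le> k" using \<open>i \<le> j\<close> that(4) by (meson enat_ord_simps(1) order_trans)
      ultimately show "0 \<le> - 1 * (a * b i)" using that(2) by simp
    qed (use that in auto)
    then show ?thesis by simp
  qed
  have pos: "0 < leverage M r j"
    if "0 < a * b 1" "\<forall>j\<ge>2. enat j \<le> k \<longrightarrow> 0 \<le> a * b j" "1 \<le> j" "enat j \<le> k" for j
  proof -
    have "0 < 1 * leverage M r j"
    proof (rule leverage_sign[OF assms(15)])
      fix i assume "2 \<le> i" "i \<le> j"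
      moreover have "enat i \<le> k" using \<open>i \<le> j\<close> that(4) by (meson enat_ord_simps(1) order_trans)
      ultimately show "0 \<le> 1 * (a * b i)" using that(2) by simp
    qed (use that in auto)
    then show ?thesis by simp
  qed
  show ?thesis unfolding has_leverage_of_order_def using neg pos by blast
qed

end
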